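(* Let $n\ge1$ and let $(Q,\sigma)$ be the equioriented symmetric quiver of type $A_{2n}$: vertices $1,\dots,2n$, arrows $a_i:i\to i+1$ ($1\le i\le 2n-1$), $\sigma(i)=2n+1-i$, $\sigma(a_i)=a_{2n-i}$. Let $\alpha$ be a symmetric dimension vector written $(\alpha_1,\dots,\alpha_n)$ with $\alpha_i=\alpha_{2n+1-i}$, and for $V\in ORep(Q,\alpha)$ write $V(a_i)$ for the maps of the corresponding orthogonal representation (so $V(a_n):V_n\to V_n^*$ is skew-symmetric and $V(a_{2n-i})=-V(a_i)^t$). Then $OSI(Q,\alpha)$ is generated by the following semi-invariants: (i) $\det(V(a_i)\cdots V(a_j))$ for $1\le j\le i\le n-1$ such that $\alpha_j=\alpha_{i+1}<\min\{\alpha_{j+1},\dots,\alpha_i\}$ (vacuous minimum condition when $i=j$); (ii) $\mathrm{pf}(V(a_{2n-i})\cdots V(a_i))$ (Pfaffian of the skew-symmetric map $V_i\to V_i^*$) for $1\le i\le n$ such that $\alpha_i<\min\{\alpha_{i+1},\dots,\alpha_n\}$ (vacuous when $i=n$) and $\alpha_i$ is even.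
   Context: $\mathbb{K}$ is algebraically closed of characteristic 0. Here $Q_0^+=\{1,\dots,n\}$, $Q_1^+=\{a_1,\dots,a_{n-1}\}$, $Q_1^\sigma=\{a_n\}$, $ORep(Q,\alpha)=\bigoplus_{i=1}^{n-1}\mathrm{Hom}(\mathbb{K}^{\alpha_i},\mathbb{K}^{\alpha_{i+1}})\oplus\bigwedge^2(\mathbb{K}^{\alpha_n})^*$, with the action of $SO(Q,\alpha)=\prod_{i=1}^n SL(\alpha_i)$ by $g\cdot V=(g_{ha}V(a)g_{ta}^{-1})$, $g_{\sigma(x)}:=(g_x^{-1})^t$; $OSI(Q,\alpha)=\mathbb{K}[ORep(Q,\alpha)]^{SO(Q,\alpha)}$. $\mathrm{pf}$ denotes the Pfaffian, $\mathrm{pf}(A)^2=\det A$. *)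

theory Defs
  imports "Jordan_Normal_Form.Determinant" "HOL-Computational_Algebra.Polynomial"
    "HOL-Combinatorics.Permutations"
begin

(* Orthogonal representations of the equioriented symmetric quiver of type A_{2n},
   dimension vector alpha given on vertices 1..n (alpha_i = alpha_{2n+1-i}).
   V i (1 <= i < n) is the alpha(i+1) x alpha(i) matrix of V(a_i);
   V n is the skew-symmetric alpha(n) x alpha(n) matrix of V(a_n) : V_n -> V_n^*.
   All other components are the empty matrix (to make the representation unique). *)
definition ORep :: "nat \<Rightarrow> (nat \<Rightarrow> nat) \<Rightarrow> (nat \<Rightarrow> 'a::field mat) set" where
  "ORep n \<alpha> = {V. (\<forall>i\<in>{1..<n}. V i \<in> carrier_mat (\<alpha> (Suc i)) (\<alpha> i))
      \<and> V n \<in> carrier_mat (\<alpha> n) (\<alpha> n) \<and> transpose_mat (V n) = - V n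
      \<and> (\<forall>i. i \<notin> {1..n} \<longrightarrow> V i = 0\<^sub>m 0 0)}"

definition SOgrp :: "nat \<Rightarrow> (nat \<Rightarrow> nat) \<Rightarrow> (nat \<Rightarrow> 'a::field mat) set" where
  "SOgrp n \<alpha> = {g. \<forall>i\<in>{1..n}. g i \<in> carrier_mat (\<alpha> i) (\<alpha> i) \<and> det (g i) = 1}"

definition mat_inv :: "'a::field mat \<Rightarrow> 'a mat" where
  "mat_inv A = (SOME B. inverts_mat A B \<and> inverts_mat B A)"

(* g . V = (g_{ha} V(a) g_{ta}^{-1}), with g_{sigma(n)} = (g_n^{-1})^t *)
definition act :: "nat \<Rightarrow> (nat \<Rightarrow> 'a::field mat) \<Rightarrow> (nat \<Rightarrow> 'a mat) \<Rightarrow> (nat \<Rightarrow> 'a mat)" where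
  "act n g V = (\<lambda>i. if 1 \<le> i \<and> i < n then g (Suc i) * V i * mat_inv (g i)
      else if i = n then transpose_mat (mat_inv (g n)) * V n * mat_inv (g n)
      else V i)"

inductive_set poly_fun :: "nat \<Rightarrow> (nat \<Rightarrow> nat) \<Rightarrow> ((nat \<Rightarrow> 'a::field mat) \<Rightarrow> 'a) set"
  for n :: nat and \<alpha> :: "nat \<Rightarrow> nat" where
  const: "(\<lambda>V. c) \<in> poly_fun n \<alpha>"
| coord1: "1 \<le> i \<Longrightarrow> i < n \<Longrightarrow> r < \<alpha> (Suc i) \<Longrightarrow> s < \<alpha> i \<Longrightarrow>
      (\<lambda>V. V i $$ (r, s)) \<in> poly_fun n \<alpha>"
| coord2: "r < \<alpha> n \<Longrightarrow> s < \<alpha> n \<Longrightarrow> (\<lambda>V. V n $$ (r, s)) \<in> poly_fun n \<alpha>"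
| add: "f \<in> poly_fun n \<alpha> \<Longrightarrow> h \<in> poly_fun n \<alpha> \<Longrightarrow> (\<lambda>V. f V + h V) \<in> poly_fun n \<alpha>"
| mult: "f \<in> poly_fun n \<alpha> \<Longrightarrow> h \<in> poly_fun n \<alpha> \<Longrightarrow> (\<lambda>V. f V * h V) \<in> poly_fun n \<alpha>"

definition OSI :: "nat \<Rightarrow> (nat \<Rightarrow> nat) \<Rightarrow> ((nat \<Rightarrow> 'a::field mat) \<Rightarrow> 'a) set" where
  "OSI n \<alpha> = {f. (\<exists>p\<in>poly_fun n \<alpha>. \<forall>V\<in>ORep n \<alpha>. f V = p V)
      \<and> (\<forall>g\<in>SOgrp n \<alpha>. \<forall>V\<in>ORep n \<alpha>. f (act n g V) = f V)}"

inductive_set alg_gen :: "('b \<Rightarrow> 'a::field) set \<Rightarrow> ('b \<Rightarrow> 'a) set" for S where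
  const: "(\<lambda>V. c) \<in> alg_gen S"
| gen: "f \<in> S \<Longrightarrow> f \<in> alg_gen S"
| add: "f \<in> alg_gen S \<Longrightarrow> h \<in> alg_gen S \<Longrightarrow> (\<lambda>V. f V + h V) \<in> alg_gen S"
| mult: "f \<in> alg_gen S \<Longrightarrow> h \<in> alg_gen S \<Longrightarrow> (\<lambda>V. f V * h V) \<in> alg_gen S"

(* V(a_k) for 1 <= k <= 2n-1, using V(a_{2n-k}) = - V(a_k)^t *)
definition Vfull :: "nat \<Rightarrow> (nat \<Rightarrow> 'a::field mat) \<Rightarrow> nat \<Rightarrow> 'a mat" where
  "Vfull n V k = (if k \<le> n then V k else - transpose_mat (V (2 * n - k)))"

fun mprod :: "(nat \<Rightarrow> 'a::field mat) \<Rightarrow> nat \<Rightarrow> nat \<Rightarrow> 'a mat" where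
  "mprod W j 0 = W j"
| "mprod W j (Suc k) = W (j + Suc k) * mprod W j k"

definition pf :: "'a::field_char_0 mat \<Rightarrow> 'a" where
  "pf A = (let d = dim_row A; m = d div 2 in
     (\<Sum>p | p permutes {..<d}. of_int (sign p) * (\<Prod>k<m. A $$ (p (2 * k), p (2 * k + 1))))
       / (2 ^ m * of_nat (fact m)))"

definition generators :: "nat \<Rightarrow> (nat \<Rightarrow> nat) \<Rightarrow> ((nat \<Rightarrow> 'a::field_char_0 mat) \<Rightarrow> 'a) set" where
  "generators n \<alpha> =
     {f. \<exists>i j. 1 \<le> j \<and> j \<le> i \<and> i \<le> n - 1 \<and> \<alpha> j = \<alpha> (Suc i)
          \<and> (\<forall>k\<in>{j+1..i}. \<alpha> j < \<alpha> k)
          \<and> f = (\<lambda>V. det (mprod (Vfull n V) j (i - j)))}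
   \<union> {f. \<exists>i. 1 \<le> i \<and> i \<le> n \<and> (\<forall>k\<in>{i+1..n}. \<alpha> i < \<alpha> k) \<and> even (\<alpha> i)
          \<and> f = (\<lambda>V. pf (mprod (Vfull n V) i (2 * n - 2 * i)))}"

end

theory Submission
  imports Defs
begin

text \<open>
  The invariants are computed by restriction to a slice. The standard representation has partial
  identity matrices as arrows and a sum of hyperbolic planes as form; the representation
  \<open>section_rep t\<close> differs from it by the parameter \<open>t j\<close> at the last basis vector of each
  vertex \<open>j\<close>. If a generator starts at \<open>j\<close>, its value at \<open>section_rep t\<close> is \<open>t j\<close> up to a nonzero
  constant; at all other vertices the parameter can be normalised to \<open>1\<close> by a diagonal element of
  determinant one.
  Hence every polynomial function agrees on the slice with a polynomial in the generators. The
  product of the general linear groups has a dense orbit, that of the standard representation, and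
  the slice sweeps it out under the special linear groups, so the difference of an invariant and
  that polynomial vanishes identically.

  Density is established without topology: a generic representation is brought to normal form arrow
  by arrow, from left to right, because upper triangular matrices at a vertex extend to
  automorphisms of the normalised arrows before it. The generic position needed in each step is
  reached along lines on which the invariant is a polynomial in one variable.
\<close>

section \<open>Matrices\<close>

lemma index_mult_mat_sum:
  fixes A B :: "'a::semiring_0 mat"
  assumes "dim_col A = dim_row B" "r < dim_row A" "s < dim_col B"
  shows "(A * B) $$ (r, s) = (\<Sum>i<dim_row B. A $$ (r, i) * B $$ (i, s))"
  using assms by (auto simp: scalar_prod_def atLeast0LessThan)

lemma mult_mat_assoc:
  fixes A B C :: "'a::semiring_0 mat"
  assumes "dim_col A = dim_row B" "dim_col B = dim_row C"
  shows "A * B * C = A * (B * C)"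
  using assms by (intro assoc_mult_mat) auto

lemma transpose_mult_mat:
  fixes A B :: "'a::comm_semiring_0 mat"
  assumes "dim_col A = dim_row B"
  shows "transpose_mat (A * B) = transpose_mat B * transpose_mat A"
  using assms by (intro transpose_mult) auto

lemma index_skew_mat:
  fixes A :: "'a::group_add mat"
  assumes A: "A \<in> carrier_mat d d" and skew: "transpose_mat A = - A" and "r < d" "s < d"
  shows "A $$ (r, s) = - A $$ (s, r)"
proof -
  have "transpose_mat A $$ (s, r) = (- A) $$ (s, r)" by (simp only: skew)
  then show ?thesis using A \<open>r < d\<close> \<open>s < d\<close> by simp
qed

lemma skew_matI:
  assumes A: "A \<in> carrier_mat d d"
    and skew: "\<And>r s. r < d \<Longrightarrow> s < d \<Longrightarrow> A $$ (r, s) = - A $$ (s, r)"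
  shows "transpose_mat A = - A"
proof (rule eq_matI)
  fix r s assume "r < dim_row (- A)" "s < dim_col (- A)"
  then show "transpose_mat A $$ (r, s) = (- A) $$ (r, s)"
    using A skew[of s r] by simp
qed (use A in auto)

lemma skew_mat_congruence:
  fixes A B :: "'a::comm_ring_1 mat"
  assumes "A \<in> carrier_mat d d" "transpose_mat A = - A" "B \<in> carrier_mat d e"
  shows "transpose_mat (transpose_mat B * A * B) = - (transpose_mat B * A * B)"
proof -
  have "transpose_mat (transpose_mat B * A * B) = transpose_mat B * (transpose_mat A * B)"
    using assms(1,3) by (simp add: transpose_mult_mat)
  also have "\<dots> = - (transpose_mat B * A * B)"
    unfolding assms(2) using assms(1,3) by (simp add: mult_mat_assoc)
  finally show ?thesis .
qed

lemma
  fixes A :: "'a::field mat"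
  assumes A: "A \<in> carrier_mat d d" and "det A \<noteq> 0"
  shows mat_inv_carrier: "mat_inv A \<in> carrier_mat d d"
    and mat_inv_right: "A * mat_inv A = 1\<^sub>m d"
    and mat_inv_left: "mat_inv A * A = 1\<^sub>m d"
    and det_mat_inv: "det (mat_inv A) = inverse (det A)"
proof -
  obtain B where B: "B \<in> carrier_mat d d" "B * A = 1\<^sub>m d" "A * B = 1\<^sub>m d"
    using det_non_zero_imp_unit[OF assms, of "()"] by (auto simp: Units_def ring_mat_def)
  have "inverts_mat A (mat_inv A) \<and> inverts_mat (mat_inv A) A"
    unfolding mat_inv_def by (rule someI[of _ B]) (use A B in \<open>auto simp: inverts_mat_def\<close>)
  then have right: "A * mat_inv A = 1\<^sub>m d" and left: "mat_inv A * A = 1\<^sub>m (dim_row (mat_inv A))"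
    using A by (auto simp: inverts_mat_def)
  have "dim_col (mat_inv A) = d" using arg_cong[OF right, of dim_col] by simp
  moreover have "dim_row (mat_inv A) = d" using arg_cong[OF left, of dim_col] A by simp
  ultimately show carrier: "mat_inv A \<in> carrier_mat d d" by auto
  show "A * mat_inv A = 1\<^sub>m d" by (fact right)
  show "mat_inv A * A = 1\<^sub>m d" using left carrier by auto
  have "det A * det (mat_inv A) = 1" using det_mult[OF A carrier] right by simp
  then show "det (mat_inv A) = inverse (det A)" by (metis inverse_unique)
qed

lemma mat_inv_mult:
  fixes A B :: "'a::field mat"
  assumes A: "A \<in> carrier_mat d d" "det A \<noteq> 0" and B: "B \<in> carrier_mat d d" "det B \<noteq> 0"
  shows "mat_inv (A * B) = mat_inv B * mat_inv A"
proof -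
  let ?C = "mat_inv B * mat_inv A"
  note inv = mat_inv_carrier[OF A] mat_inv_carrier[OF B]
  have AB: "A * B \<in> carrier_mat d d" "det (A * B) \<noteq> 0"
    using A B by (simp_all add: det_mult[OF A(1) B(1)])
  note inv_AB = mat_inv_carrier[OF AB]
  have "A * B * ?C = A * (B * mat_inv B) * mat_inv A"
    using A(1) B(1) inv by (simp add: mult_mat_assoc)
  also have "\<dots> = 1\<^sub>m d"
    using A(1) mat_inv_right[OF A] mat_inv_right[OF B] by simp
  finally have "mat_inv (A * B) = mat_inv (A * B) * (A * B * ?C)"
    using inv_AB by simp
  also have "\<dots> = mat_inv (A * B) * (A * B) * ?C"
    using AB(1) inv inv_AB by (intro mult_mat_assoc[symmetric]) auto
  also have "\<dots> = ?C" unfolding mat_inv_left[OF AB] using inv by simp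
  finally show ?thesis .
qed

lemma mat_inv_mult_cancel:
  fixes A :: "'a::field mat"
  assumes A: "A \<in> carrier_mat d d" "det A \<noteq> 0" and "dim_row X = d"
  shows "mat_inv A * (A * X) = X"
proof -
  have "mat_inv A * (A * X) = mat_inv A * A * X"
    using A(1) mat_inv_carrier[OF A] assms(3) by (intro mult_mat_assoc[symmetric]) auto
  then show ?thesis using assms(3) by (simp add: mat_inv_left[OF A])
qed

lemma transpose_mat_inv_mult_cancel:
  fixes A :: "'a::field mat"
  assumes A: "A \<in> carrier_mat d d" "det A \<noteq> 0" and "dim_row X = d"
  shows "transpose_mat A * (transpose_mat (mat_inv A) * X) = X"
    and "transpose_mat (mat_inv A) * (transpose_mat A * X) = X"
proof -
  note inv = mat_inv_carrier[OF A]
  have "transpose_mat A * (transpose_mat (mat_inv A) * X) = transpose_mat (mat_inv A * A) * X"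
    using A(1) inv assms(3) by (simp add: transpose_mult_mat mult_mat_assoc)
  then show "transpose_mat A * (transpose_mat (mat_inv A) * X) = X"
    using assms(3) by (simp add: mat_inv_left[OF A])
  have "transpose_mat (mat_inv A) * (transpose_mat A * X) = transpose_mat (A * mat_inv A) * X"
    using A(1) inv assms(3) by (simp add: transpose_mult_mat mult_mat_assoc)
  then show "transpose_mat (mat_inv A) * (transpose_mat A * X) = X"
    using assms(3) by (simp add: mat_inv_right[OF A])
qed

lemma det_upper_triangular_nonzero_iff:
  fixes A :: "'a::idom mat"
  assumes "upper_triangular A" and A: "A \<in> carrier_mat d d"
  shows "det A \<noteq> 0 \<longleftrightarrow> (\<forall>r<d. A $$ (r, r) \<noteq> 0)"
  unfolding det_upper_triangular[OF assms] using A by (auto simp: prod_list_diag_prod)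

subsection \<open>Rectangular diagonal matrices\<close>

definition rect_diag :: "nat \<Rightarrow> nat \<Rightarrow> (nat \<Rightarrow> 'a::zero) \<Rightarrow> 'a mat" where
  "rect_diag m k x = mat m k (\<lambda>(r, s). if r = s then x r else 0)"

abbreviation partial_id :: "nat \<Rightarrow> nat \<Rightarrow> 'a::zero_neq_one mat" where
  "partial_id m k \<equiv> rect_diag m k (\<lambda>_. 1)"

lemma rect_diag_carrier [simp]: "rect_diag m k x \<in> carrier_mat m k"
  and dim_row_rect_diag [simp]: "dim_row (rect_diag m k x) = m"
  and dim_col_rect_diag [simp]: "dim_col (rect_diag m k x) = k"
  by (auto simp: rect_diag_def)

lemma index_rect_diag [simp]:
  "r < m \<Longrightarrow> s < k \<Longrightarrow> rect_diag m k x $$ (r, s) = (if r = s then x r else 0)"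
  by (simp add: rect_diag_def)

lemma rect_diag_cong:
  "(\<And>r. r < m \<Longrightarrow> r < k \<Longrightarrow> x r = y r) \<Longrightarrow> rect_diag m k x = rect_diag m k y"
  by (intro eq_matI) auto

lemma transpose_rect_diag [simp]: "transpose_mat (rect_diag m k x) = rect_diag k m x"
  by (intro eq_matI) auto

lemma index_rect_diag_mult:
  fixes X :: "'a::semiring_0 mat"
  assumes "dim_row X = k" "r < m" "s < dim_col X"
  shows "(rect_diag m k x * X) $$ (r, s) = (if r < k then x r * X $$ (r, s) else 0)"
proof -
  have "(rect_diag m k x * X) $$ (r, s) = (\<Sum>i<k. rect_diag m k x $$ (r, i) * X $$ (i, s))"
    using assms by (subst index_mult_mat_sum) auto
  also have "\<dots> = (\<Sum>i<k. if i = r then x r * X $$ (r, s) else 0)"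
    using assms by (intro sum.cong) auto
  finally show ?thesis by simp
qed

lemma index_mult_rect_diag:
  fixes X :: "'a::semiring_0 mat"
  assumes "dim_col X = m" "r < dim_row X" "s < k"
  shows "(X * rect_diag m k x) $$ (r, s) = (if s < m then X $$ (r, s) * x s else 0)"
proof -
  have "(X * rect_diag m k x) $$ (r, s) = (\<Sum>i<m. X $$ (r, i) * rect_diag m k x $$ (i, s))"
    using assms by (subst index_mult_mat_sum) auto
  also have "\<dots> = (\<Sum>i<m. if i = s then X $$ (r, s) * x s else 0)"
    using assms by (intro sum.cong) auto
  finally show ?thesis by simp
qed

lemma rect_diag_mult:
  fixes x y :: "nat \<Rightarrow> 'a::semiring_0"
  shows "rect_diag m k x * rect_diag k l y = rect_diag m l (\<lambda>r. if r < k then x r * y r else 0)"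
  by (intro eq_matI) (auto simp: index_rect_diag_mult simp del: index_mult_mat(1))

lemma det_rect_diag: "det (rect_diag d d x) = (\<Prod>r<d. x r :: 'a::idom)"
proof -
  have "det (rect_diag d d x) = prod_list (diag_mat (rect_diag d d x))"
    by (rule det_upper_triangular[of _ d]) auto
  then show ?thesis by (simp add: prod_list_diag_prod atLeast0LessThan)
qed

subsection \<open>Triangular reduction\<close>

lemma upper_triangular_mult_partial_id:
  fixes U :: "'a::idom mat"
  assumes U: "U \<in> carrier_mat m m" "upper_triangular U" "det U \<noteq> 0"
  obtains U' where "U' \<in> carrier_mat k k" "upper_triangular U'" "det U' \<noteq> 0"
    "U * partial_id m k = partial_id m k * U'"
proof
  define U' where "U' = mat k k
    (\<lambda>(r, s). if r < m \<and> s < m then U $$ (r, s) else if r = s then 1 else 0)"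
  show U'_carrier: "U' \<in> carrier_mat k k" by (simp add: U'_def)
  show U'_upper: "upper_triangular U'"
    using U(1) upper_triangularD[OF U(2)] by (auto simp: U'_def)
  have "U $$ (r, r) \<noteq> 0" if "r < m" for r
    using det_upper_triangular_nonzero_iff[OF U(2,1)] U(3) that by blast
  then show "det U' \<noteq> 0"
    by (simp add: det_upper_triangular_nonzero_iff[OF U'_upper U'_carrier]) (simp add: U'_def)
  show "U * partial_id m k = partial_id m k * U'"
    using U(1) upper_triangularD[OF U(2)]
    by (intro eq_matI)
      (auto simp: index_rect_diag_mult index_mult_rect_diag U'_def simp del: index_mult_mat(1))
qed

text \<open>The completion is invertible iff the leading maximal square block is.\<close>

definition completion :: "'a::zero_neq_one mat \<Rightarrow> 'a mat" where
  "completion X = mat (dim_row X) (dim_row X)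
     (\<lambda>(r, s). if s < dim_col X then X $$ (r, s) else if r = s then 1 else 0)"

lemma completion_carrier: "X \<in> carrier_mat m k \<Longrightarrow> completion X \<in> carrier_mat m m"
  by (auto simp: completion_def)

lemma completion_partial_id: "completion (partial_id m k) = 1\<^sub>m m"
  by (intro eq_matI) (auto simp: completion_def)

lemma completion_normal_form:
  fixes X :: "'a::field mat"
  assumes X: "X \<in> carrier_mat m k" and nz: "det (completion X) \<noteq> 0"
  obtains U where "U \<in> carrier_mat k k" "upper_triangular U" "det U \<noteq> 0"
    "mat_inv (completion X) * X = partial_id m k * U"
proof
  define H where "H = completion X"
  have H: "H \<in> carrier_mat m m" "det H \<noteq> 0"
    using nz completion_carrier[OF X] by (auto simp: H_def)
  note inv = mat_inv_carrier[OF H]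
  have leading: "(mat_inv H * X) $$ (r, s) = (if r = s then 1 else 0)"
    if "r < m" "s < m" "s < k" for r s
  proof -
    have "(mat_inv H * X) $$ (r, s) = (mat_inv H * H) $$ (r, s)"
      using that X H inv
      by (auto simp: index_mult_mat_sum H_def completion_def simp del: index_mult_mat(1))
    then show ?thesis using that by (simp add: mat_inv_left[OF H])
  qed
  define U where
    "U = mat k k (\<lambda>(r, s). if r < m then (mat_inv H * X) $$ (r, s) else if r = s then 1 else 0)"
  show U: "U \<in> carrier_mat k k" by (simp add: U_def)
  show upper: "upper_triangular U"
    by (rule upper_triangularI) (auto simp: U_def leading simp del: index_mult_mat(1))
  have "U $$ (r, r) = 1" if "r < k" for r
    using leading[of r r] that by (simp add: U_def del: index_mult_mat(1))
  then show "det U \<noteq> 0" by (simp add: det_upper_triangular_nonzero_iff[OF upper U])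
  show "mat_inv (completion X) * X = partial_id m k * U"
    unfolding H_def[symmetric] using X inv U leading
    by (intro eq_matI) (auto simp: index_rect_diag_mult U_def simp del: index_mult_mat(1))
qed

section \<open>Skew-symmetric matrices and Pfaffians\<close>

subsection \<open>Sums of hyperbolic planes\<close>

definition hyperbolic :: "nat \<Rightarrow> nat \<Rightarrow> 'a::comm_ring_1" where
  "hyperbolic r s =
     (if even r \<and> s = Suc r then 1 else if even s \<and> r = Suc s then -1 else 0)"

lemma hyperbolic_skew: "hyperbolic r s = - hyperbolic s r"
  by (auto simp: hyperbolic_def)

lemma hyperbolic_nonzero_iff:
  "hyperbolic r s \<noteq> (0::'a::comm_ring_1) \<longleftrightarrow> even r \<and> s = Suc r \<or> even s \<and> r = Suc s"
  by (auto simp: hyperbolic_def)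

lemma hyperbolic_partner:
  "hyperbolic r s \<noteq> (0::'a::comm_ring_1) \<Longrightarrow> r = 2 * e \<longleftrightarrow> s = 2 * e + 1"
  unfolding hyperbolic_nonzero_iff by presburger

lemma hyperbolic_eq_0_across: "r < 2 * k \<Longrightarrow> 2 * k \<le> s \<Longrightarrow> hyperbolic r s = 0"
  by (auto simp: hyperbolic_def)

lemma hyperbolic_diag [simp]: "hyperbolic r r = 0"
  by (simp add: hyperbolic_def)

definition hyperbolic_mat :: "nat \<Rightarrow> (nat \<Rightarrow> 'a::comm_ring_1) \<Rightarrow> 'a mat" where
  "hyperbolic_mat d x = mat d d (\<lambda>(r, s). hyperbolic r s * x r * x s)"

lemma hyperbolic_mat_carrier [simp]: "hyperbolic_mat d x \<in> carrier_mat d d"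
  and dim_row_hyperbolic_mat [simp]: "dim_row (hyperbolic_mat d x) = d"
  and dim_col_hyperbolic_mat [simp]: "dim_col (hyperbolic_mat d x) = d"
  by (auto simp: hyperbolic_mat_def)

lemma index_hyperbolic_mat [simp]:
  "r < d \<Longrightarrow> s < d \<Longrightarrow> hyperbolic_mat d x $$ (r, s) = hyperbolic r s * x r * x s"
  by (simp add: hyperbolic_mat_def)

lemma hyperbolic_mat_cong:
  assumes "\<And>r. r < d \<Longrightarrow> x r = y r"
  shows "hyperbolic_mat d x = hyperbolic_mat d y"
  using assms by (intro eq_matI) auto

lemma transpose_hyperbolic_mat [simp]: "transpose_mat (hyperbolic_mat d x) = - hyperbolic_mat d x"
proof (rule skew_matI)
  fix r s assume "r < d" "s < d"
  then show "hyperbolic_mat d x $$ (r, s) = - hyperbolic_mat d x $$ (s, r)"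
    by (simp add: hyperbolic_skew[of r s] mult_ac)
qed simp

lemma rect_diag_congruence_hyperbolic_mat:
  fixes x y :: "nat \<Rightarrow> 'a::comm_ring_1"
  shows "transpose_mat (rect_diag d e y) * hyperbolic_mat d x * rect_diag d e y
    = hyperbolic_mat e (\<lambda>r. if r < d then x r * y r else 0)"
proof (rule eq_matI)
  fix r s assume "r < dim_row (hyperbolic_mat e (\<lambda>r. if r < d then x r * y r else 0))"
    "s < dim_col (hyperbolic_mat e (\<lambda>r. if r < d then x r * y r else 0))"
  then have "r < e" "s < e" by auto
  then show "(transpose_mat (rect_diag d e y) * hyperbolic_mat d x * rect_diag d e y) $$ (r, s)
    = hyperbolic_mat e (\<lambda>r. if r < d then x r * y r else 0) $$ (r, s)"
    by (simp add: index_mult_rect_diag index_rect_diag_mult mult_ac del: index_mult_mat(1))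
qed simp_all

lemma rect_diag_congruence_smult_hyperbolic_mat:
  fixes x y :: "nat \<Rightarrow> 'a::comm_ring_1"
  shows "transpose_mat (rect_diag d e y) * (c \<cdot>\<^sub>m hyperbolic_mat d x) * rect_diag d e y
    = c \<cdot>\<^sub>m hyperbolic_mat e (\<lambda>r. if r < d then x r * y r else 0)"
proof -
  have "rect_diag e d y * hyperbolic_mat d x \<in> carrier_mat e d" by auto
  then have "rect_diag e d y * (c \<cdot>\<^sub>m hyperbolic_mat d x) * rect_diag d e y
      = c \<cdot>\<^sub>m (rect_diag e d y * hyperbolic_mat d x * rect_diag d e y)"
    by (simp only: mult_smult_distrib[OF rect_diag_carrier hyperbolic_mat_carrier]
        mult_smult_assoc_mat[OF _ rect_diag_carrier])
  then have "transpose_mat (rect_diag d e y) * (c \<cdot>\<^sub>m hyperbolic_mat d x) * rect_diag d e y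
      = c \<cdot>\<^sub>m (transpose_mat (rect_diag d e y) * hyperbolic_mat d x * rect_diag d e y)"
    by (simp only: transpose_rect_diag)
  then show ?thesis by (simp only: rect_diag_congruence_hyperbolic_mat)
qed

definition hyperbolic_upto :: "nat \<Rightarrow> 'a::comm_ring_1 mat \<Rightarrow> bool" where
  "hyperbolic_upto k A \<longleftrightarrow> (\<forall>r<dim_row A. \<forall>s<dim_col A.
     r < 2 * k \<or> s < 2 * k \<longrightarrow> A $$ (r, s) = hyperbolic r s)"

lemma hyperbolic_upto_hyperbolic_mat: "hyperbolic_upto k (hyperbolic_mat d (\<lambda>_. 1))"
  by (simp add: hyperbolic_upto_def)

lemma hyperbolic_upto_eq_hyperbolic_mat:
  fixes A :: "'a::field_char_0 mat"
  assumes A: "A \<in> carrier_mat d d" "transpose_mat A = - A"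
    and upto: "hyperbolic_upto k A" and "d \<le> 2 * k + 1"
  shows "A = hyperbolic_mat d (\<lambda>_. 1)"
proof (rule eq_matI)
  fix r s assume "r < dim_row (hyperbolic_mat d (\<lambda>_. 1 :: 'a))"
    "s < dim_col (hyperbolic_mat d (\<lambda>_. 1 :: 'a))"
  then have rs: "r < d" "s < d" by auto
  show "A $$ (r, s) = hyperbolic_mat d (\<lambda>_. 1) $$ (r, s)"
  proof (cases "r < 2 * k \<or> s < 2 * k")
    case True
    then show ?thesis using upto A(1) rs by (auto simp: hyperbolic_upto_def)
  next
    case False
    then have "r = s" using assms(4) rs by linarith
    then show ?thesis using index_skew_mat[OF A rs] rs by simp
  qed
qed (use A in auto)

lemma mult_mat_eq_self:
  fixes C U :: "'a::semiring_1 mat"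
  assumes C: "C \<in> carrier_mat m d" and U: "U \<in> carrier_mat d d"
    and unit: "\<And>r i s. r < m \<Longrightarrow> i < d \<Longrightarrow> s < d \<Longrightarrow> C $$ (r, i) \<noteq> 0 \<Longrightarrow>
      U $$ (i, s) = (if i = s then 1 else 0)"
  shows "C * U = C"
proof (rule eq_matI)
  fix r s assume "r < dim_row C" "s < dim_col C"
  then have rs: "r < m" "s < d" using C by auto
  have "(C * U) $$ (r, s) = (\<Sum>i<d. C $$ (r, i) * U $$ (i, s))"
    using rs C U by (subst index_mult_mat_sum) auto
  also have "\<dots> = (\<Sum>i<d. if i = s then C $$ (r, s) else 0)"
  proof (intro sum.cong refl)
    fix i assume "i \<in> {..<d}"
    then show "C $$ (r, i) * U $$ (i, s) = (if i = s then C $$ (r, s) else 0)"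
      using unit[OF rs(1) _ rs(2), of i] by (cases "C $$ (r, i) = 0") auto
  qed
  finally show "(C * U) $$ (r, s) = C $$ (r, s)" using rs by simp
qed (use C U in auto)

definition plane_mat :: "nat \<Rightarrow> nat \<Rightarrow> nat \<Rightarrow> 'a::ring_1 mat" where
  "plane_mat d p q = mat d d
     (\<lambda>(r, s). if r = p \<and> s = q then 1 else if r = q \<and> s = p then -1 else 0)"

lemma plane_mat_carrier: "plane_mat d p q \<in> carrier_mat d d"
  by (simp add: plane_mat_def)

lemma plane_mat_congruence:
  fixes U :: "'a::comm_ring_1 mat"
  assumes U: "U \<in> carrier_mat d e" and pq: "p < d" "q < d" "p \<noteq> q"
  shows "transpose_mat U * plane_mat d p q * U
    = mat e e (\<lambda>(r, s). U $$ (p, r) * U $$ (q, s) - U $$ (q, r) * U $$ (p, s))"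
proof (rule eq_matI, goal_cases)
  case (1 r s)
  then have rs: "r < e" "s < e" by auto
  note E = plane_mat_carrier[of d p q, where ?'a = 'a]
  have EU: "(plane_mat d p q * U) $$ (i, s)
      = (if i = p then U $$ (q, s) else 0) - (if i = q then U $$ (p, s) else 0)" if "i < d" for i
  proof -
    have "(plane_mat d p q * U) $$ (i, s) = (\<Sum>j<d. plane_mat d p q $$ (i, j) * U $$ (j, s))"
      using that rs U E by (subst index_mult_mat_sum) auto
    also have "\<dots> = (\<Sum>j<d. (if j = q then if i = p then U $$ (q, s) else 0 else 0)
        - (if j = p then if i = q then U $$ (p, s) else 0 else 0))"
      using that pq by (intro sum.cong) (auto simp: plane_mat_def)
    finally show ?thesis using pq by (simp add: sum_subtractf)
  qed
  have "(transpose_mat U * plane_mat d p q * U) $$ (r, s)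
      = (transpose_mat U * (plane_mat d p q * U)) $$ (r, s)"
    using U E by (simp add: mult_mat_assoc del: index_mult_mat(1))
  also have "\<dots> = (\<Sum>i<d. transpose_mat U $$ (r, i) * (plane_mat d p q * U) $$ (i, s))"
    using rs U E by (subst index_mult_mat_sum) (auto simp del: index_mult_mat(1))
  also have "\<dots> = (\<Sum>i<d. (if i = p then U $$ (p, r) * U $$ (q, s) else 0)
      - (if i = q then U $$ (q, r) * U $$ (p, s) else 0))"
    using rs pq U by (intro sum.cong) (auto simp: EU simp del: index_mult_mat(1))
  finally show ?case using rs pq by (simp add: sum_subtractf)
qed (use U in auto)

text \<open>Row \<open>p\<close> of \<^term>\<open>pivot_forms A p q\<close> is \<open>A e\<^sub>q\<close> divided by the pivot, row \<open>q\<close> is \<open>- A e\<^sub>p\<close>. The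
  wedge product of these two linear forms is the part of \<open>A\<close> that the elimination splits off.\<close>

definition pivot_forms :: "'a::field mat \<Rightarrow> nat \<Rightarrow> nat \<Rightarrow> 'a mat" where
  "pivot_forms A p q = mat (dim_row A) (dim_row A) (\<lambda>(r, s).
     if r = p then A $$ (s, q) / A $$ (p, q) else if r = q then A $$ (p, s)
     else if r = s then 1 else 0)"

definition skew_schur_complement :: "'a::field mat \<Rightarrow> nat \<Rightarrow> nat \<Rightarrow> 'a mat" where
  "skew_schur_complement A p q = mat (dim_row A) (dim_row A) (\<lambda>(r, s).
     A $$ (r, s) - (A $$ (r, q) * A $$ (p, s) - A $$ (p, r) * A $$ (s, q)) / A $$ (p, q))"

context
  fixes A :: "'a::field_char_0 mat" and d p q
  assumes A: "A \<in> carrier_mat d d" "transpose_mat A = - A"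
    and pq: "p < d" "q < d" "p \<noteq> q" and pivot: "A $$ (p, q) \<noteq> 0"
begin

lemma pivot_forms_carrier: "pivot_forms A p q \<in> carrier_mat d d"
  and skew_schur_complement_carrier: "skew_schur_complement A p q \<in> carrier_mat d d"
  using A(1) by (auto simp: pivot_forms_def skew_schur_complement_def)

lemma skew_schur_complement_skew:
  "transpose_mat (skew_schur_complement A p q) = - skew_schur_complement A p q"
proof (rule skew_matI[OF skew_schur_complement_carrier])
  fix r s assume "r < d" "s < d"
  then show "skew_schur_complement A p q $$ (r, s) = - skew_schur_complement A p q $$ (s, r)"
    using index_skew_mat[OF A, of r s] A(1)
    by (simp add: skew_schur_complement_def diff_divide_distrib mult.commute)
qed

lemma skew_schur_complement_eq_0:
  assumes "r < d"
  shows "skew_schur_complement A p q $$ (r, p) = 0" "skew_schur_complement A p q $$ (r, q) = 0"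
  using assms A(1) pq pivot index_skew_mat[OF A, of r p] index_skew_mat[OF A, of p p]
    index_skew_mat[OF A, of q q] by (auto simp: skew_schur_complement_def)

lemma plane_add_complement_skew:
  "transpose_mat (plane_mat d p q + skew_schur_complement A p q)
    = - (plane_mat d p q + skew_schur_complement A p q)"
proof (rule skew_matI)
  fix r s assume rs: "r < d" "s < d"
  have "skew_schur_complement A p q $$ (r, s) = - skew_schur_complement A p q $$ (s, r)"
    by (rule index_skew_mat[OF skew_schur_complement_carrier skew_schur_complement_skew rs])
  then show "(plane_mat d p q + skew_schur_complement A p q) $$ (r, s)
      = - (plane_mat d p q + skew_schur_complement A p q) $$ (s, r)"
    using rs pq(3) skew_schur_complement_carrier by (auto simp: plane_mat_def)
qed (use skew_schur_complement_carrier in simp)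

lemma skew_pivot_decomposition:
  "A = transpose_mat (pivot_forms A p q) * (plane_mat d p q + skew_schur_complement A p q)
     * pivot_forms A p q"
proof -
  let ?U = "pivot_forms A p q" and ?C = "skew_schur_complement A p q" and ?E = "plane_mat d p q"
  note U = pivot_forms_carrier and C = skew_schur_complement_carrier
  note E = plane_mat_carrier[of d p q, where ?'a = 'a]
  have CU: "?C * ?U = ?C"
  proof (rule mult_mat_eq_self[OF C U])
    fix r i s assume "r < d" "i < d" "s < d" "?C $$ (r, i) \<noteq> 0"
    then have "i \<noteq> p" "i \<noteq> q" using skew_schur_complement_eq_0 by auto
    then show "?U $$ (i, s) = (if i = s then 1 else 0)"
      using \<open>i < d\<close> \<open>s < d\<close> A(1) by (simp add: pivot_forms_def)
  qed
  have "transpose_mat ?U * ?C = - transpose_mat (?C * ?U)"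
    using C U by (simp add: transpose_mult_mat skew_schur_complement_skew)
  then have UC: "transpose_mat ?U * ?C = ?C" by (simp add: CU skew_schur_complement_skew)
  have "transpose_mat ?U * (?E + ?C) * ?U
      = transpose_mat ?U * ?E * ?U + transpose_mat ?U * ?C * ?U"
    using U E C by (simp add: mult_add_distrib_mat[of _ d d _ d]
        add_mult_distrib_mat[of _ d d _ _ d] del: assoc_mult_mat)
  also have "\<dots> = A"
    unfolding UC CU plane_mat_congruence[OF U pq] using A(1) pq
    by (intro eq_matI) (auto simp: skew_schur_complement_def pivot_forms_def diff_divide_distrib)
  finally show ?thesis by simp
qed

context
  fixes k
  assumes p: "p = 2 * k" and q: "q = Suc (2 * k)" and upto: "hyperbolic_upto k A"
begin

lemma hyperbolic_upto_index: "r < d \<Longrightarrow> s < d \<Longrightarrow> r < p \<or> s < p \<Longrightarrow> A $$ (r, s) = hyperbolic r s"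
  using upto A(1) by (auto simp: hyperbolic_upto_def p)

lemma pivot_entries_eq_0:
  assumes "s < p"
  shows "A $$ (s, q) = 0" "A $$ (p, s) = 0"
  using assms pq hyperbolic_upto_index[of s q] hyperbolic_upto_index[of p s]
    hyperbolic_eq_0_across[of s k, where ?'a = 'a]
  by (simp_all add: hyperbolic_skew[of "2 * k" s] p q)

lemma upper_triangular_pivot_forms: "upper_triangular (pivot_forms A p q)"
proof -
  have "A $$ (p, p) = 0" "A $$ (q, q) = 0"
    using index_skew_mat[OF A, of p p] index_skew_mat[OF A, of q q] pq by auto
  then show ?thesis
    using A(1) pivot_entries_eq_0
    by (intro upper_triangularI) (auto simp: pivot_forms_def p q less_Suc_eq)
qed

lemma det_pivot_forms_nonzero: "det (pivot_forms A p q) \<noteq> 0"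
  unfolding det_upper_triangular_nonzero_iff[OF upper_triangular_pivot_forms pivot_forms_carrier]
  using pivot A(1) by (auto simp: pivot_forms_def)

lemma hyperbolic_upto_Suc_pivot:
  "hyperbolic_upto (Suc k) (plane_mat d p q + skew_schur_complement A p q)"
proof -
  define C where "C = skew_schur_complement A p q"
  define B where "B = plane_mat d p q + C"
  note C = skew_schur_complement_carrier[folded C_def]
  have B: "B \<in> carrier_mat d d" using C by (simp add: B_def)
  have B_skew: "transpose_mat B = - B"
    unfolding B_def C_def by (rule plane_add_complement_skew)
  have index_B: "B $$ (r, s)
      = (if r = p \<and> s = q then 1 else if r = q \<and> s = p then -1 else 0) + C $$ (r, s)"
    if "r < d" "s < d" for r s
    using that C by (simp add: B_def plane_mat_def)
  have low: "B $$ (r, s) = hyperbolic r s" if "r < d" "s < d" "r < p" for r s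
    using that A(1) hyperbolic_upto_index[of r s] pivot_entries_eq_0[of r]
    by (auto simp: index_B C_def skew_schur_complement_def p q)
  have "hyperbolic r p = (if r = q then - 1 else 0 :: 'a)"
    "hyperbolic r q = (if r = p then 1 else 0 :: 'a)" for r
    unfolding p q hyperbolic_def by (auto; presburger)+
  then have plane: "B $$ (r, s) = hyperbolic r s" if "r < d" "s \<in> {p, q}" for r s
    using that pq skew_schur_complement_eq_0[OF that(1)] by (auto simp: index_B C_def)
  have "B $$ (r, s) = hyperbolic r s" if rs: "r < d" "s < d" "r < 2 * Suc k \<or> s < 2 * Suc k" for r s
  proof -
    have "r < p \<or> s < p \<or> s \<in> {p, q} \<or> r \<in> {p, q}" using rs(3) by (auto simp: p q)
    then show ?thesis
      using rs low plane index_skew_mat[OF B B_skew rs(1,2)] hyperbolic_skew[of r s] by metis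
  qed
  then have "hyperbolic_upto (Suc k) B" using B by (auto simp: hyperbolic_upto_def)
  then show ?thesis by (simp only: B_def C_def)
qed

end

end

lemma split_hyperbolic_plane:
  fixes A :: "'a::field_char_0 mat"
  assumes A: "A \<in> carrier_mat d d" "transpose_mat A = - A"
    and k: "2 * k + 1 < d" and upto: "hyperbolic_upto k A"
    and pivot: "A $$ (2 * k, 2 * k + 1) \<noteq> 0"
  obtains U B where "U \<in> carrier_mat d d" "upper_triangular U" "det U \<noteq> 0"
    "B \<in> carrier_mat d d" "transpose_mat B = - B" "hyperbolic_upto (Suc k) B"
    "A = transpose_mat U * B * U"
proof -
  define p q where "p = 2 * k" and "q = Suc (2 * k)"
  have pq: "p < d" "q < d" "p \<noteq> q" and nz: "A $$ (p, q) \<noteq> 0"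
    using k pivot by (auto simp: p_def q_def)
  note pivot_facts = A pq nz and upto_facts = A pq nz p_def q_def upto
  show thesis
  proof (rule that)
    show "A = transpose_mat (pivot_forms A p q)
        * (plane_mat d p q + skew_schur_complement A p q) * pivot_forms A p q"
      by (rule skew_pivot_decomposition[OF pivot_facts])
    show "plane_mat d p q + skew_schur_complement A p q \<in> carrier_mat d d"
      using skew_schur_complement_carrier[OF pivot_facts] by simp
  qed (rule pivot_forms_carrier[OF pivot_facts] upper_triangular_pivot_forms[OF upto_facts]
      det_pivot_forms_nonzero[OF upto_facts] hyperbolic_upto_Suc_pivot[OF upto_facts]
      plane_add_complement_skew[OF pivot_facts])+
qed

subsection \<open>The Pfaffian\<close>

definition pf_term :: "nat \<Rightarrow> (nat \<Rightarrow> nat \<Rightarrow> 'a::comm_ring_1) \<Rightarrow> (nat \<Rightarrow> nat) \<Rightarrow> 'a" where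
  "pf_term m a p = of_int (sign p) * (\<Prod>k<m. a (p (2 * k)) (p (2 * k + 1)))"

definition pf_sum :: "nat \<Rightarrow> 'a::comm_ring_1 mat \<Rightarrow> 'a" where
  "pf_sum m A = (\<Sum>p | p permutes {..<2 * m}. pf_term m (\<lambda>r s. A $$ (r, s)) p)"

lemma pf_eq_pf_sum:
  "A \<in> carrier_mat (2 * m) (2 * m) \<Longrightarrow> pf A = pf_sum m A / (2 ^ m * of_nat (fact m))"
  by (simp add: pf_def pf_sum_def pf_term_def)

lemma pf_term_cong:
  assumes "p permutes {..<2 * m}" "\<And>r s. r < 2 * m \<Longrightarrow> s < 2 * m \<Longrightarrow> a r s = b r s"
  shows "pf_term m a p = pf_term m b p"
  unfolding pf_term_def
  using assms permutes_in_image[OF assms(1)]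
  by (intro arg_cong2[of _ _ _ _ "(*)"] prod.cong refl) auto

lemma pf_smult:
  fixes A :: "'a::field_char_0 mat"
  assumes A: "A \<in> carrier_mat (2 * m) (2 * m)"
  shows "pf (c \<cdot>\<^sub>m A) = c ^ m * pf A"
proof -
  have "pf_term m (\<lambda>r s. (c \<cdot>\<^sub>m A) $$ (r, s)) p = c ^ m * pf_term m (\<lambda>r s. A $$ (r, s)) p"
    if "p permutes {..<2 * m}" for p
  proof -
    have "pf_term m (\<lambda>r s. (c \<cdot>\<^sub>m A) $$ (r, s)) p = pf_term m (\<lambda>r s. c * A $$ (r, s)) p"
      using A by (intro pf_term_cong[OF that]) auto
    then show ?thesis by (simp add: pf_term_def prod.distrib mult_ac)
  qed
  then have "pf_sum m (c \<cdot>\<^sub>m A) = c ^ m * pf_sum m A"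
    by (simp add: pf_sum_def sum_distrib_left)
  then show ?thesis
    by (simp add: pf_eq_pf_sum[OF A] pf_eq_pf_sum[OF smult_carrier_mat[OF A]])
qed

lemma prod_pairs:
  fixes g :: "nat \<Rightarrow> 'a::comm_monoid_mult"
  shows "(\<Prod>k<m. g (2 * k) * g (2 * k + 1)) = (\<Prod>i<2 * m. g i)"
  by (induction m) (auto simp: mult.assoc)

lemma index_congruence_mat:
  fixes A B :: "'a::comm_ring_1 mat"
  assumes A: "A \<in> carrier_mat d d" and B: "B \<in> carrier_mat d e" and "r < e" "s < e"
  shows "(transpose_mat B * A * B) $$ (r, s)
    = (\<Sum>x\<in>{..<d} \<times> {..<d}. A $$ x * (B $$ (fst x, r) * B $$ (snd x, s)))"
proof -
  have "(transpose_mat B * A * B) $$ (r, s) = (\<Sum>j<d. (transpose_mat B * A) $$ (r, j) * B $$ (j, s))"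
    using assms by (subst index_mult_mat_sum) auto
  also have "\<dots> = (\<Sum>j<d. (\<Sum>i<d. B $$ (i, r) * A $$ (i, j)) * B $$ (j, s))"
    using assms by (intro sum.cong refl arg_cong2[of _ _ _ _ "(*)"], subst index_mult_mat_sum) auto
  also have "\<dots> = (\<Sum>j<d. \<Sum>i<d. A $$ (i, j) * (B $$ (i, r) * B $$ (j, s)))"
    by (simp add: sum_distrib_left sum_distrib_right mult_ac)
  also have "\<dots> = (\<Sum>x\<in>{..<d} \<times> {..<d}. A $$ x * (B $$ (fst x, r) * B $$ (snd x, s)))"
    by (subst sum.swap) (simp add: sum.cartesian_product case_prod_beta)
  finally show ?thesis .
qed

definition row_selection :: "nat \<Rightarrow> (nat \<Rightarrow> nat) \<Rightarrow> 'a::zero_neq_one mat" where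
  "row_selection d q = mat d d (\<lambda>(i, j). if j = q i then 1 else 0)"

lemma row_selection_carrier: "row_selection d q \<in> carrier_mat d d"
  by (simp add: row_selection_def)

lemma row_selection_mult:
  fixes B :: "'a::comm_ring_1 mat"
  assumes B: "B \<in> carrier_mat d d" and q: "\<And>i. i < d \<Longrightarrow> q i < d"
  shows "row_selection d q * B = mat d d (\<lambda>(i, j). B $$ (q i, j))"
proof (rule eq_matI)
  fix i j assume "i < dim_row (mat d d (\<lambda>(i, j). B $$ (q i, j)))"
    "j < dim_col (mat d d (\<lambda>(i, j). B $$ (q i, j)))"
  then have ij: "i < d" "j < d" by auto
  have "(row_selection d q * B) $$ (i, j) = (\<Sum>a<d. row_selection d q $$ (i, a) * B $$ (a, j))"
    using B ij by (subst index_mult_mat_sum) (auto simp: row_selection_def)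
  also have "\<dots> = (\<Sum>a<d. if a = q i then B $$ (a, j) else 0)"
    using ij by (intro sum.cong) (auto simp: row_selection_def)
  finally show "(row_selection d q * B) $$ (i, j) = mat d d (\<lambda>(i, j). B $$ (q i, j)) $$ (i, j)"
    using ij q[OF ij(1)] by simp
qed (use B in \<open>auto simp: row_selection_def\<close>)

lemma sum_permutes_selected_rows:
  fixes B :: "'a::comm_ring_1 mat"
  assumes B: "B \<in> carrier_mat d d" and q: "\<And>i. i < d \<Longrightarrow> q i < d"
  shows "(\<Sum>p | p permutes {..<d}. of_int (sign p) * (\<Prod>i<d. B $$ (q i, p i)))
    = det B * det (row_selection d q)"
proof -
  have "det B * det (row_selection d q) = det (mat d d (\<lambda>(i, j). B $$ (q i, j)))"
    using det_mult[OF row_selection_carrier B, of q] row_selection_mult[OF assms]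
    by (simp add: mult.commute)
  also have "\<dots> = (\<Sum>p | p permutes {..<d}. signof p *
      (\<Prod>i<d. mat d d (\<lambda>(i, j). B $$ (q i, j)) $$ (i, p i)))"
    by (subst det_def'[of _ d]) (auto simp: atLeast0LessThan)
  also have "\<dots> = (\<Sum>p | p permutes {..<d}. of_int (sign p) * (\<Prod>i<d. B $$ (q i, p i)))"
  proof (intro sum.cong refl arg_cong2[of _ _ _ _ "(*)"] prod.cong)
    fix p i assume "p \<in> {p. p permutes {..<d}}" "i \<in> {..<d}"
    then show "mat d d (\<lambda>(i, j). B $$ (q i, j)) $$ (i, p i) = B $$ (q i, p i)"
      using permutes_in_image[of p "{..<d}"] by auto
  qed
  finally show ?thesis by simp
qed

definition interleave :: "(nat \<Rightarrow> nat \<times> nat) \<Rightarrow> nat \<Rightarrow> nat" where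
  "interleave \<phi> i = (if even i then fst (\<phi> (i div 2)) else snd (\<phi> (i div 2)))"

lemma pf_term_congruence:
  fixes A B :: "'a::comm_ring_1 mat"
  assumes A: "A \<in> carrier_mat (2 * m) (2 * m)" and B: "B \<in> carrier_mat (2 * m) (2 * m)"
    and p: "p permutes {..<2 * m}"
  shows "pf_term m (\<lambda>r s. (transpose_mat B * A * B) $$ (r, s)) p
    = (\<Sum>\<phi>\<in>{..<m} \<rightarrow>\<^sub>E {..<2 * m} \<times> {..<2 * m}.
        (\<Prod>k<m. A $$ \<phi> k) * (of_int (sign p) * (\<Prod>i<2 * m. B $$ (interleave \<phi> i, p i))))"
    (is "_ = (\<Sum>\<phi>\<in>?\<Phi>. ?f \<phi>)")
proof -
  define M where "M x r s = B $$ (fst x, r) * B $$ (snd x, s)" for x r s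
  have "pf_term m (\<lambda>r s. (transpose_mat B * A * B) $$ (r, s)) p
      = pf_term m (\<lambda>r s. \<Sum>x\<in>{..<2 * m} \<times> {..<2 * m}. A $$ x * M x r s) p"
    unfolding M_def by (rule pf_term_cong[OF p]) (rule index_congruence_mat[OF A B])
  also have "\<dots> = (\<Sum>\<phi>\<in>?\<Phi>. of_int (sign p) *
      (\<Prod>k<m. A $$ \<phi> k * M (\<phi> k) (p (2 * k)) (p (2 * k + 1))))"
    unfolding pf_term_def by (subst prod_sum_PiE) (auto simp: sum_distrib_left)
  also have "\<dots> = (\<Sum>\<phi>\<in>?\<Phi>. ?f \<phi>)"
  proof (intro sum.cong refl)
    fix \<phi>
    have "(\<Prod>k<m. M (\<phi> k) (p (2 * k)) (p (2 * k + 1))) = (\<Prod>i<2 * m. B $$ (interleave \<phi> i, p i))"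
      using prod_pairs[of "\<lambda>i. B $$ (interleave \<phi> i, p i)" m]
      by (simp add: interleave_def M_def)
    then show "of_int (sign p) * (\<Prod>k<m. A $$ \<phi> k * M (\<phi> k) (p (2 * k)) (p (2 * k + 1))) = ?f \<phi>"
      by (simp add: prod.distrib mult_ac)
  qed
  finally show ?thesis .
qed

lemma pf_sum_congruence:
  fixes A B :: "'a::comm_ring_1 mat"
  assumes A: "A \<in> carrier_mat (2 * m) (2 * m)" and B: "B \<in> carrier_mat (2 * m) (2 * m)"
  shows "pf_sum m (transpose_mat B * A * B) = det B *
    (\<Sum>\<phi>\<in>{..<m} \<rightarrow>\<^sub>E {..<2 * m} \<times> {..<2 * m}.
      (\<Prod>k<m. A $$ \<phi> k) * det (row_selection (2 * m) (interleave \<phi>)))"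
    (is "_ = det B * (\<Sum>\<phi>\<in>?\<Phi>. _)")
proof -
  have "pf_sum m (transpose_mat B * A * B) = (\<Sum>p | p permutes {..<2 * m}. \<Sum>\<phi>\<in>?\<Phi>.
      (\<Prod>k<m. A $$ \<phi> k) * (of_int (sign p) * (\<Prod>i<2 * m. B $$ (interleave \<phi> i, p i))))"
    unfolding pf_sum_def by (intro sum.cong refl pf_term_congruence[OF A B]) simp
  also have "\<dots> = (\<Sum>\<phi>\<in>?\<Phi>. (\<Prod>k<m. A $$ \<phi> k) * (\<Sum>p | p permutes {..<2 * m}.
      of_int (sign p) * (\<Prod>i<2 * m. B $$ (interleave \<phi> i, p i))))"
    by (subst sum.swap) (simp add: sum_distrib_left)
  also have "\<dots> = (\<Sum>\<phi>\<in>?\<Phi>. (\<Prod>k<m. A $$ \<phi> k) *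
      (det B * det (row_selection (2 * m) (interleave \<phi>))))"
  proof (intro sum.cong refl arg_cong2[of _ _ _ _ "(*)"] sum_permutes_selected_rows[OF B])
    fix \<phi> i assume \<phi>: "\<phi> \<in> ?\<Phi>" and "i < 2 * m"
    then have "\<phi> (i div 2) \<in> {..<2 * m} \<times> {..<2 * m}"
      by (intro PiE_mem[OF \<phi>]) auto
    then show "interleave \<phi> i < 2 * m" by (auto simp: interleave_def mem_Times_iff)
  qed
  finally show ?thesis by (simp add: sum_distrib_left mult_ac)
qed

text \<open>The cofactor of \<^term>\<open>det B\<close> in the previous lemma does not depend on \<open>B\<close>; it is read off
  at \<open>B = 1\<close>.\<close>

lemma pf_congruence:
  fixes A B :: "'a::field_char_0 mat"
  assumes A: "A \<in> carrier_mat (2 * m) (2 * m)" and B: "B \<in> carrier_mat (2 * m) (2 * m)"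
  shows "pf (transpose_mat B * A * B) = det B * pf A"
proof -
  have "pf_sum m (transpose_mat B * A * B)
      = det B * pf_sum m (transpose_mat (1\<^sub>m (2 * m)) * A * 1\<^sub>m (2 * m))"
    unfolding pf_sum_congruence[OF A B] pf_sum_congruence[OF A one_carrier_mat] by simp
  moreover have "transpose_mat (1\<^sub>m (2 * m)) * A * 1\<^sub>m (2 * m) = A" using A by simp
  moreover have "transpose_mat B * A * B \<in> carrier_mat (2 * m) (2 * m)" using A B by simp
  ultimately show ?thesis using A by (simp add: pf_eq_pf_sum)
qed

subsection \<open>The Pfaffian of a sum of hyperbolic planes\<close>

lemma pf_term_flip:
  fixes a :: "nat \<Rightarrow> nat \<Rightarrow> 'a::comm_ring_1"
  assumes skew: "\<And>r s. a r s = - a s r" and p: "p permutes {..<2 * m}" and l: "l < m"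
  shows "pf_term m a (p \<circ> Transposition.transpose (2 * l) (2 * l + 1)) = pf_term m a p"
proof -
  define p' where "p' = p \<circ> Transposition.transpose (2 * l) (2 * l + 1)"
  have factor: "a (p' (2 * k)) (p' (2 * k + 1))
      = (if k = l then -1 else 1) * a (p (2 * k)) (p (2 * k + 1))" for k
  proof (cases "k = l")
    case True
    then show ?thesis using skew[of "p (2 * l + 1)" "p (2 * l)"] by (simp add: p'_def)
  next
    case False
    then have "2 * k + 1 \<noteq> 2 * l" "2 * k \<noteq> 2 * l + 1" by presburger+
    then show ?thesis using False by (simp add: p'_def Transposition.transpose_def)
  qed
  have "sign p' = - sign p"
    unfolding p'_def using p
    by (subst sign_compose)
      (auto simp: permutation_swap_id sign_swap_id intro: permutation_permutes[THEN iffD2])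
  then have "pf_term m a p' = pf_term m a p"
    using l by (simp only: pf_term_def factor prod.distrib) simp
  then show ?thesis by (simp only: p'_def)
qed

definition double_perm :: "(nat \<Rightarrow> nat) \<Rightarrow> nat \<Rightarrow> nat" where
  "double_perm \<pi> i = 2 * \<pi> (i div 2) + i mod 2"

lemma double_perm_permutes_sign:
  assumes "\<pi> permutes {..<m}"
  shows "double_perm \<pi> permutes {..<2 * m} \<and> sign (double_perm \<pi>) = 1"
  using assms finite_lessThan
proof (induction rule: permutes_induct)
  case id
  have "double_perm id = id" by (auto simp: double_perm_def)
  show ?case unfolding \<open>double_perm id = id\<close> by (simp add: permutes_id[unfolded id_def] id_def)
next
  case (swap a b \<pi>)
  define t where "t = Transposition.transpose (2 * a) (2 * b)
    \<circ> Transposition.transpose (2 * a + 1) (2 * b + 1)"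
  have eq: "double_perm (Transposition.transpose a b \<circ> \<pi>) = t \<circ> double_perm \<pi>"
  proof
    fix i :: nat
    have "i mod 2 = 0 \<or> i mod 2 = 1" by auto
    then show "double_perm (Transposition.transpose a b \<circ> \<pi>) i = (t \<circ> double_perm \<pi>) i"
      by (auto simp: t_def double_perm_def Transposition.transpose_def)
  qed
  have t: "t permutes {..<2 * m}"
    unfolding t_def using swap by (intro permutes_compose permutes_swap_id) auto
  have "sign t = 1"
    unfolding t_def by (subst sign_compose) (auto simp: permutation_swap_id sign_swap_id)
  then have "sign (t \<circ> double_perm \<pi>) = 1"
    using t swap.IH by (subst sign_compose) (auto intro: permutation_permutes[THEN iffD2])
  then show ?case using swap.IH permutes_compose[OF _ t] by (simp only: eq)
qed

lemma pair_preserving_eq_double_perm: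
  assumes p: "p permutes {..<2 * m}"
    and pairs: "\<And>k. k < m \<Longrightarrow> even (p (2 * k)) \<and> p (2 * k + 1) = Suc (p (2 * k))"
  obtains \<pi> where "\<pi> permutes {..<m}" "p = double_perm \<pi>"
proof
  define \<pi> where "\<pi> k = (if k < m then p (2 * k) div 2 else k)" for k
  show p_eq: "p = double_perm \<pi>"
  proof
    fix i
    show "p i = double_perm \<pi> i"
    proof (cases "i < 2 * m")
      case True
      then have "i div 2 < m" by auto
      then have "p (2 * (i div 2) + i mod 2) = double_perm \<pi> i"
        using pairs[of "i div 2"]
        by (cases "even i") (auto simp: \<pi>_def double_perm_def odd_iff_mod_2_eq_one)
      then show ?thesis by simp
    next
      case False
      then show ?thesis using p by (auto simp: permutes_def \<pi>_def double_perm_def)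
    qed
  qed
  show "\<pi> permutes {..<m}"
  proof (rule bij_imp_permutes)
    have "\<pi> k < m" if "k < m" for k
      using permutes_in_image[OF p, of "2 * k"] that by (auto simp: \<pi>_def)
    moreover have "inj_on \<pi> {..<m}"
    proof (rule inj_onI)
      fix a b assume "\<pi> a = \<pi> b"
      then have "p (2 * a) = p (2 * b)" unfolding p_eq by (simp add: double_perm_def)
      then show "a = b" using injD[OF permutes_inj[OF p]] by force
    qed
    ultimately show "bij_betw \<pi> {..<m} {..<m}"
      unfolding bij_betw_def by (intro conjI endo_inj_surj) auto
  qed (simp add: \<pi>_def)
qed

lemma pf_term_hyperbolic_oriented:
  assumes p: "p permutes {..<2 * m}" and nz: "pf_term m hyperbolic p \<noteq> (0::'a::idom)"
    and even: "\<And>k. k < m \<Longrightarrow> even (p (2 * k))"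
  shows "pf_term m hyperbolic p = (1::'a)"
proof -
  have pair: "p (2 * k + 1) = Suc (p (2 * k))" if "k < m" for k
  proof -
    have "hyperbolic (p (2 * k)) (p (2 * k + 1)) \<noteq> (0::'a)"
      using nz that by (auto simp: pf_term_def)
    then show ?thesis using even[OF that] by (auto simp: hyperbolic_nonzero_iff)
  qed
  obtain \<pi> where "\<pi> permutes {..<m}" "p = double_perm \<pi>"
    using pair_preserving_eq_double_perm[OF p] even pair by metis
  then have "sign p = 1" using double_perm_permutes_sign by blast
  moreover have "hyperbolic (p (2 * k)) (p (2 * k + 1)) = (1::'a)" if "k < m" for k
    using pair[OF that] even[OF that] by (simp add: hyperbolic_def)
  ultimately show ?thesis by (simp add: pf_term_def)
qed

text \<open>Flips reduce to permutations that preserve all pairs \<open>(2k, 2k + 1)\<close> and their orientation.\<close>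

lemma pf_term_hyperbolic:
  assumes "p permutes {..<2 * m}" "pf_term m hyperbolic p \<noteq> (0::'a::idom)"
  shows "pf_term m hyperbolic p = (1::'a)"
  using assms
proof (induction "card {k. k < m \<and> odd (p (2 * k))}" arbitrary: p)
  case 0
  then show ?case by (intro pf_term_hyperbolic_oriented) auto
next
  case (Suc c)
  then have "{k. k < m \<and> odd (p (2 * k))} \<noteq> {}" by (metis card.empty nat.distinct(1))
  then obtain l where l: "l < m" "odd (p (2 * l))" by auto
  define p' where "p' = p \<circ> Transposition.transpose (2 * l) (2 * l + 1)"
  have p': "p' permutes {..<2 * m}"
    unfolding p'_def using l Suc.prems by (intro permutes_compose permutes_swap_id) auto
  have flip: "pf_term m hyperbolic p' = (pf_term m hyperbolic p :: 'a)"
    unfolding p'_def by (rule pf_term_flip[OF hyperbolic_skew Suc.prems(1) l(1)])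
  have "hyperbolic (p (2 * l)) (p (2 * l + 1)) \<noteq> (0::'a)"
    using Suc.prems(2) l(1) by (auto simp: pf_term_def)
  then have "even (p' (2 * l))"
    using l(2) by (auto simp: hyperbolic_nonzero_iff p'_def)
  moreover have "p' (2 * k) = p (2 * k)" if "k \<noteq> l" for k
  proof -
    have "2 * k \<noteq> 2 * l + 1" by presburger
    then show ?thesis using that by (simp add: p'_def Transposition.transpose_def)
  qed
  ultimately have "{k. k < m \<and> odd (p' (2 * k))} = {k. k < m \<and> odd (p (2 * k))} - {l}"
    by (auto split: if_splits) metis+
  then have "c = card {k. k < m \<and> odd (p' (2 * k))}"
    using Suc.hyps(2) l by simp
  from Suc.hyps(1)[OF this p'] Suc.prems(2) show ?case by (simp add: flip)
qed

lemma pf_hyperbolic_mat_nonzero: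
  "pf (hyperbolic_mat (2 * m) (\<lambda>_. 1)) \<noteq> (0::'a::field_char_0)"
proof -
  define P where "P = {p. p permutes {..<2 * m}}"
  define R where "R = {p \<in> P. pf_term m hyperbolic p \<noteq> (0::'a)}"
  have fin: "finite P" by (simp add: P_def finite_permutations)
  have "pf_sum m (hyperbolic_mat (2 * m) (\<lambda>_. 1)) = (\<Sum>p\<in>P. pf_term m hyperbolic p :: 'a)"
    unfolding pf_sum_def P_def by (intro sum.cong refl pf_term_cong) auto
  also have "\<dots> = (\<Sum>p\<in>R. pf_term m hyperbolic p)"
    by (rule sum.mono_neutral_right) (auto simp: R_def fin)
  also have "\<dots> = (\<Sum>p\<in>R. 1)"
    by (intro sum.cong refl pf_term_hyperbolic) (auto simp: R_def P_def)
  also have "\<dots> \<noteq> 0"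
  proof -
    have "pf_term m hyperbolic id = (1::'a)"
      by (auto simp: pf_term_def hyperbolic_def intro!: prod.neutral)
    then have "id \<in> R" by (simp add: R_def P_def permutes_id)
    then show ?thesis using fin by (auto simp: R_def)
  qed
  finally show ?thesis by (simp add: pf_eq_pf_sum[of _ m])
qed

lemma pf_hyperbolic_mat:
  fixes x :: "nat \<Rightarrow> 'a::field_char_0"
  shows "pf (hyperbolic_mat (2 * m) x)
    = (\<Prod>r<2 * m. x r) * pf (hyperbolic_mat (2 * m) (\<lambda>_. 1))"
proof -
  let ?d = "2 * m"
  have "hyperbolic_mat ?d x = hyperbolic_mat ?d (\<lambda>r. if r < ?d then 1 * x r else 0)"
    by (intro eq_matI) auto
  then have "hyperbolic_mat ?d x
      = transpose_mat (rect_diag ?d ?d x) * hyperbolic_mat ?d (\<lambda>_. 1) * rect_diag ?d ?d x"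
    by (simp only: rect_diag_congruence_hyperbolic_mat)
  then show ?thesis
    by (simp only: pf_congruence[OF hyperbolic_mat_carrier rect_diag_carrier] det_rect_diag)
qed

section \<open>Algebras of functions\<close>

locale function_algebra =
  fixes D :: "'b set" and S :: "('b \<Rightarrow> 'a::field_char_0) set"
  assumes const: "(\<lambda>x. c) \<in> S"
    and add: "f \<in> S \<Longrightarrow> h \<in> S \<Longrightarrow> (\<lambda>x. f x + h x) \<in> S"
    and mult: "f \<in> S \<Longrightarrow> h \<in> S \<Longrightarrow> (\<lambda>x. f x * h x) \<in> S"
    and cong: "f \<in> S \<Longrightarrow> (\<And>x. x \<in> D \<Longrightarrow> f x = h x) \<Longrightarrow> h \<in> S"
begin

lemma sum: "finite I \<Longrightarrow> (\<And>i. i \<in> I \<Longrightarrow> f i \<in> S) \<Longrightarrow> (\<lambda>x. \<Sum>i\<in>I. f i x) \<in> S"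
  by (induction rule: finite_induct) (auto intro: const add)

lemma prod: "finite I \<Longrightarrow> (\<And>i. i \<in> I \<Longrightarrow> f i \<in> S) \<Longrightarrow> (\<lambda>x. \<Prod>i\<in>I. f i x) \<in> S"
  by (induction rule: finite_induct) (auto intro: const mult)

lemma uminus: "f \<in> S \<Longrightarrow> (\<lambda>x. - f x) \<in> S"
  using mult[OF const[of "-1"], of f] by simp

lemma diff: "f \<in> S \<Longrightarrow> h \<in> S \<Longrightarrow> (\<lambda>x. f x - h x) \<in> S"
  using add[OF _ uminus, of f h] by simp

lemma alg_gen_subset:
  assumes "X \<subseteq> S"
  shows "alg_gen X \<subseteq> S"
proof
  show "f \<in> S" if "f \<in> alg_gen X" for f
    using that by induction (use assms in \<open>auto intro: const add mult\<close>)
qed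

definition Mat :: "nat \<Rightarrow> nat \<Rightarrow> ('b \<Rightarrow> 'a mat) set" where
  "Mat l m = {A. (\<forall>x\<in>D. A x \<in> carrier_mat l m) \<and> (\<forall>r<l. \<forall>s<m. (\<lambda>x. A x $$ (r, s)) \<in> S)}"

lemma Mat_I:
  assumes "\<And>x. x \<in> D \<Longrightarrow> A x \<in> carrier_mat l m"
    and "\<And>r s. r < l \<Longrightarrow> s < m \<Longrightarrow> (\<lambda>x. A x $$ (r, s)) \<in> S"
  shows "A \<in> Mat l m"
  using assms by (auto simp: Mat_def)

lemma Mat_carrier: "A \<in> Mat l m \<Longrightarrow> x \<in> D \<Longrightarrow> A x \<in> carrier_mat l m"
  and Mat_entry: "A \<in> Mat l m \<Longrightarrow> r < l \<Longrightarrow> s < m \<Longrightarrow> (\<lambda>x. A x $$ (r, s)) \<in> S"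
  by (auto simp: Mat_def)

lemma Mat_const: "A \<in> carrier_mat l m \<Longrightarrow> (\<lambda>x. A) \<in> Mat l m"
  by (auto intro: Mat_I const)

lemma Mat_cong: "A \<in> Mat l m \<Longrightarrow> (\<And>x. x \<in> D \<Longrightarrow> A x = B x) \<Longrightarrow> B \<in> Mat l m"
  by (rule Mat_I) (metis Mat_carrier, metis (no_types, lifting) Mat_entry cong)

lemma Mat_mult:
  assumes A: "A \<in> Mat l m" and B: "B \<in> Mat m k"
  shows "(\<lambda>x. A x * B x) \<in> Mat l k"
proof (rule Mat_I)
  show "A x * B x \<in> carrier_mat l k" if "x \<in> D" for x
    using Mat_carrier[OF A that] Mat_carrier[OF B that] by simp
  fix r s assume rs: "r < l" "s < k"
  have "(\<lambda>x. \<Sum>i<m. A x $$ (r, i) * B x $$ (i, s)) \<in> S"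
    by (intro sum mult Mat_entry[OF A] Mat_entry[OF B] rs) auto
  then show "(\<lambda>x. (A x * B x) $$ (r, s)) \<in> S"
  proof (rule cong)
    fix x assume "x \<in> D"
    then show "(\<Sum>i<m. A x $$ (r, i) * B x $$ (i, s)) = (A x * B x) $$ (r, s)"
      using Mat_carrier[OF A \<open>x \<in> D\<close>] Mat_carrier[OF B \<open>x \<in> D\<close>] rs
      by (subst index_mult_mat_sum) auto
  qed
qed

lemma Mat_transpose:
  assumes A: "A \<in> Mat l m"
  shows "(\<lambda>x. transpose_mat (A x)) \<in> Mat m l"
proof (rule Mat_I)
  show "transpose_mat (A x) \<in> carrier_mat m l" if "x \<in> D" for x
    using Mat_carrier[OF A that] by simp
  show "(\<lambda>x. transpose_mat (A x) $$ (r, s)) \<in> S" if "r < m" "s < l" for r s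
    by (rule cong[OF Mat_entry[OF A that(2,1)]]) (use that in \<open>auto dest!: Mat_carrier[OF A]\<close>)
qed

lemma Mat_uminus:
  assumes A: "A \<in> Mat l m"
  shows "(\<lambda>x. - A x) \<in> Mat l m"
proof (rule Mat_I)
  show "- A x \<in> carrier_mat l m" if "x \<in> D" for x
    using Mat_carrier[OF A that] by simp
  show "(\<lambda>x. (- A x) $$ (r, s)) \<in> S" if "r < l" "s < m" for r s
    by (rule cong[OF uminus[OF Mat_entry[OF A that]]]) (use that in \<open>auto dest!: Mat_carrier[OF A]\<close>)
qed

lemma Mat_completion:
  assumes A: "A \<in> Mat l m"
  shows "(\<lambda>x. completion (A x)) \<in> Mat l l"
proof (rule Mat_I)
  show "completion (A x) \<in> carrier_mat l l" if "x \<in> D" for x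
    by (rule completion_carrier[OF Mat_carrier[OF A that]])
  fix r s assume rs: "r < l" "s < l"
  have "(\<lambda>x. if s < m then A x $$ (r, s) else if r = s then 1 else 0) \<in> S"
    using Mat_entry[OF A rs(1)] by (cases "s < m") (auto intro: const)
  then show "(\<lambda>x. completion (A x) $$ (r, s)) \<in> S"
    by (rule cong) (use rs in \<open>auto simp: completion_def dest!: Mat_carrier[OF A]\<close>)
qed

lemma det:
  assumes A: "A \<in> Mat m m"
  shows "(\<lambda>x. det (A x)) \<in> S"
proof -
  have "(\<lambda>x. \<Sum>p\<in>{p. p permutes {0..<m}}. signof p * (\<Prod>i\<in>{0..<m}. A x $$ (i, p i))) \<in> S"
    by (intro sum mult prod const Mat_entry[OF A] finite_permutations)
      (auto simp: permutes_in_image[of _ "{0..<m}", simplified])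
  then show ?thesis
    by (rule cong) (rule det_def'[OF Mat_carrier[OF A], symmetric])
qed

lemma pf:
  assumes A: "A \<in> Mat (2 * m) (2 * m)"
  shows "(\<lambda>x. pf (A x)) \<in> S"
proof -
  have "(\<lambda>x. pf_sum m (A x)) \<in> S"
    unfolding pf_sum_def pf_term_def
    by (intro sum mult prod const Mat_entry[OF A] finite_permutations)
      (auto simp: permutes_in_image[of _ "{..<2 * m}", unfolded lessThan_iff])
  then have "(\<lambda>x. inverse (2 ^ m * of_nat (fact m)) * pf_sum m (A x)) \<in> S"
    by (rule mult[OF const])
  then show ?thesis
    by (rule cong) (simp add: pf_eq_pf_sum[OF Mat_carrier[OF A]] divide_inverse)
qed

lemma poly_fun_comp:
  assumes "p \<in> poly_fun n \<alpha>"
    and arrow: "\<And>i. 1 \<le> i \<Longrightarrow> i < n \<Longrightarrow> (\<lambda>x. \<phi> x i) \<in> Mat (\<alpha> (Suc i)) (\<alpha> i)"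
    and form: "(\<lambda>x. \<phi> x n) \<in> Mat (\<alpha> n) (\<alpha> n)"
  shows "(\<lambda>x. p (\<phi> x)) \<in> S"
  using assms(1)
proof induction
  case (coord1 i r s)
  then show ?case by (intro Mat_entry[OF arrow])
next
  case (coord2 r s)
  then show ?case by (intro Mat_entry[OF form])
qed (auto intro: const add mult)

end

definition agreeing_on :: "'b set \<Rightarrow> ('b \<Rightarrow> 'a) set \<Rightarrow> ('b \<Rightarrow> 'a) set" where
  "agreeing_on D S = {f. \<exists>h\<in>S. \<forall>x\<in>D. f x = h x}"

lemma agreeing_onI: "h \<in> S \<Longrightarrow> (\<And>x. x \<in> D \<Longrightarrow> f x = h x) \<Longrightarrow> f \<in> agreeing_on D S"
  by (auto simp: agreeing_on_def)

lemma agreeing_onE: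
  assumes "f \<in> agreeing_on D S"
  obtains h where "h \<in> S" "\<And>x. x \<in> D \<Longrightarrow> f x = h x"
  using assms unfolding agreeing_on_def by blast

lemma function_algebra_agreeing_on:
  fixes S :: "('b \<Rightarrow> 'a::field_char_0) set"
  assumes const: "\<And>c. (\<lambda>x. c) \<in> S"
    and add: "\<And>f h. f \<in> S \<Longrightarrow> h \<in> S \<Longrightarrow> (\<lambda>x. f x + h x) \<in> S"
    and mult: "\<And>f h. f \<in> S \<Longrightarrow> h \<in> S \<Longrightarrow> (\<lambda>x. f x * h x) \<in> S"
  shows "function_algebra D (agreeing_on D S)"
proof
  show "(\<lambda>x. c) \<in> agreeing_on D S" for c
    by (rule agreeing_onI[OF const]) simp
  fix f h assume f: "f \<in> agreeing_on D S"
  then obtain f' where f': "f' \<in> S" "\<And>x. x \<in> D \<Longrightarrow> f x = f' x" by (rule agreeing_onE) blast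
  show "h \<in> agreeing_on D S" if "\<And>x. x \<in> D \<Longrightarrow> f x = h x"
    by (rule agreeing_onI[OF f'(1)]) (simp add: f'(2) flip: that)
  assume "h \<in> agreeing_on D S"
  then obtain h' where h': "h' \<in> S" "\<And>x. x \<in> D \<Longrightarrow> h x = h' x" by (rule agreeing_onE) blast
  show "(\<lambda>x. f x + h x) \<in> agreeing_on D S"
    by (rule agreeing_onI[OF add[OF f'(1) h'(1)]]) (simp add: f'(2) h'(2))
  show "(\<lambda>x. f x * h x) \<in> agreeing_on D S"
    by (rule agreeing_onI[OF mult[OF f'(1) h'(1)]]) (simp add: f'(2) h'(2))
qed

lemma function_algebra_poly_fun:
  "function_algebra D (agreeing_on D (poly_fun n \<alpha> :: ((nat \<Rightarrow> 'a::field_char_0 mat) \<Rightarrow> 'a) set))"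
  by (intro function_algebra_agreeing_on poly_fun.intros)

lemma function_algebra_alg_gen:
  "function_algebra D (agreeing_on D (alg_gen X :: ('b \<Rightarrow> 'a::field_char_0) set))"
  by (intro function_algebra_agreeing_on alg_gen.const alg_gen.add alg_gen.mult)

lemma function_algebra_range_poly:
  "function_algebra UNIV (range (poly :: 'a::field_char_0 poly \<Rightarrow> 'a \<Rightarrow> 'a))"
proof
  show "(\<lambda>x. c) \<in> range poly" for c :: 'a
    by (rule range_eqI[of _ _ "[:c:]"]) auto
  fix f h :: "'a \<Rightarrow> 'a" assume "f \<in> range poly"
  then obtain p where p: "f = poly p" by auto
  show "h \<in> range poly" if "\<And>x. x \<in> UNIV \<Longrightarrow> f x = h x"
    using that by (intro range_eqI[of _ _ p]) (auto simp: p)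
  assume "h \<in> range poly"
  then obtain q where q: "h = poly q" by auto
  show "(\<lambda>x. f x + h x) \<in> range poly"
    by (rule range_eqI[of _ _ "p + q"]) (simp add: p q fun_eq_iff)
  show "(\<lambda>x. f x * h x) \<in> range poly"
    by (rule range_eqI[of _ _ "p * q"]) (simp add: p q fun_eq_iff)
qed

subsection \<open>Lines of matrices\<close>

definition mat_line :: "'a::field mat \<Rightarrow> 'a mat \<Rightarrow> 'a \<Rightarrow> 'a mat" where
  "mat_line A B x = A + x \<cdot>\<^sub>m (B - A)"

lemma mat_line_carrier:
  "A \<in> carrier_mat l m \<Longrightarrow> B \<in> carrier_mat l m \<Longrightarrow> mat_line A B x \<in> carrier_mat l m"
  unfolding mat_line_def by (intro add_carrier_mat smult_carrier_mat minus_carrier_mat)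

lemma index_mat_line:
  assumes "A \<in> carrier_mat l m" "B \<in> carrier_mat l m" "r < l" "s < m"
  shows "mat_line A B x $$ (r, s) = A $$ (r, s) + x * (B $$ (r, s) - A $$ (r, s))"
  using assms by (simp add: mat_line_def)

lemma hyperbolic_upto_mat_line:
  assumes "A \<in> carrier_mat d d" "B \<in> carrier_mat d d" "hyperbolic_upto k A" "hyperbolic_upto k B"
  shows "hyperbolic_upto k (mat_line A B x)"
  unfolding hyperbolic_upto_def
proof (intro allI impI)
  fix r s assume "r < dim_row (mat_line A B x)" "s < dim_col (mat_line A B x)"
    and low: "r < 2 * k \<or> s < 2 * k"
  then have rs: "r < d" "s < d" using carrier_matD[OF mat_line_carrier[OF assms(1,2), of x]] by auto
  then have "A $$ (r, s) = hyperbolic r s" "B $$ (r, s) = hyperbolic r s"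
    using assms low by (auto simp: hyperbolic_upto_def)
  then show "mat_line A B x $$ (r, s) = hyperbolic r s"
    by (simp add: index_mat_line[OF assms(1,2) rs])
qed

lemma mat_line_self [simp]: "mat_line A A x = A"
  by (intro eq_matI) (auto simp: mat_line_def)

lemma mat_line_0: "A \<in> carrier_mat l m \<Longrightarrow> B \<in> carrier_mat l m \<Longrightarrow> mat_line A B 0 = A"
  and mat_line_1: "A \<in> carrier_mat l m \<Longrightarrow> B \<in> carrier_mat l m \<Longrightarrow> mat_line A B 1 = B"
  by (intro eq_matI; auto simp: mat_line_def)+

interpretation line: function_algebra UNIV "range poly :: ('a::field_char_0 \<Rightarrow> 'a) set"
  by (rule function_algebra_range_poly)

lemma mat_line_Mat:
  assumes "A \<in> carrier_mat l m" "B \<in> carrier_mat l m"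
  shows "mat_line A B \<in> line.Mat l m"
proof (rule line.Mat_I[OF mat_line_carrier[OF assms]])
  fix r s assume rs: "r < l" "s < m"
  show "(\<lambda>x. mat_line A B x $$ (r, s)) \<in> range poly"
    by (rule range_eqI[of _ _ "[:A $$ (r, s), B $$ (r, s) - A $$ (r, s):]"])
      (simp add: index_mat_line[OF assms rs] fun_eq_iff)
qed

section \<open>Products along a path\<close>

lemma dim_mprod [simp]:
  "dim_row (mprod W j k) = dim_row (W (j + k))" "dim_col (mprod W j k) = dim_col (W j)"
  by (induction k) auto

lemma mprod_cong:
  assumes "\<And>i. j \<le> i \<Longrightarrow> i \<le> j + k \<Longrightarrow> W i = W' i"
  shows "mprod W j k = mprod W' j k"
  using assms by (induction k) auto

lemma mprod_Suc_left:
  assumes "\<And>i. j \<le> i \<Longrightarrow> i \<le> j + k \<Longrightarrow> dim_col (W (Suc i)) = dim_row (W i)"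
  shows "mprod W j (Suc k) = mprod W (Suc j) k * W j"
  using assms
proof (induction k)
  case (Suc k)
  then have "mprod W j (Suc (Suc k)) = W (j + Suc (Suc k)) * (mprod W (Suc j) k * W j)" by simp
  also have "\<dots> = W (j + Suc (Suc k)) * mprod W (Suc j) k * W j"
    using Suc.prems[of "j + Suc k"] Suc.prems[of j]
    by (intro mult_mat_assoc[symmetric]) auto
  finally show ?case by simp
qed simp

section \<open>The action of the general linear groups\<close>

locale symmetric_quiver =
  fixes n :: nat and \<alpha> :: "nat \<Rightarrow> nat"
  assumes n_pos: "1 \<le> n"
begin

definition GL :: "(nat \<Rightarrow> 'a::field mat) set" where
  "GL = {g. \<forall>i\<in>{1..n}. g i \<in> carrier_mat (\<alpha> i) (\<alpha> i) \<and> det (g i) \<noteq> 0}"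

lemma GL_I:
  "(\<And>i. 1 \<le> i \<Longrightarrow> i \<le> n \<Longrightarrow> g i \<in> carrier_mat (\<alpha> i) (\<alpha> i)) \<Longrightarrow>
    (\<And>i. 1 \<le> i \<Longrightarrow> i \<le> n \<Longrightarrow> det (g i) \<noteq> 0) \<Longrightarrow> g \<in> GL"
  by (auto simp: GL_def)

lemma GL_D:
  assumes "g \<in> GL" "1 \<le> i" "i \<le> n"
  shows "g i \<in> carrier_mat (\<alpha> i) (\<alpha> i)" "det (g i) \<noteq> 0"
  using assms by (auto simp: GL_def)

lemma GL_inv_carrier: "g \<in> GL \<Longrightarrow> 1 \<le> i \<Longrightarrow> i \<le> n \<Longrightarrow> mat_inv (g i) \<in> carrier_mat (\<alpha> i) (\<alpha> i)"
  by (intro mat_inv_carrier GL_D)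

lemma SOgrp_D:
  assumes "g \<in> SOgrp n \<alpha>"
  shows "g \<in> GL" "1 \<le> i \<Longrightarrow> i \<le> n \<Longrightarrow> det (g i) = 1"
  using assms by (auto simp: SOgrp_def GL_def)

lemma ORep_I:
  assumes "\<And>i. 1 \<le> i \<Longrightarrow> i < n \<Longrightarrow> V i \<in> carrier_mat (\<alpha> (Suc i)) (\<alpha> i)"
    and "V n \<in> carrier_mat (\<alpha> n) (\<alpha> n)" "transpose_mat (V n) = - V n"
    and "\<And>i. i \<notin> {1..n} \<Longrightarrow> V i = 0\<^sub>m 0 0"
  shows "V \<in> ORep n \<alpha>"
  using assms by (auto simp: ORep_def)

lemma ORep_arrow: "V \<in> ORep n \<alpha> \<Longrightarrow> 1 \<le> i \<Longrightarrow> i < n \<Longrightarrow> V i \<in> carrier_mat (\<alpha> (Suc i)) (\<alpha> i)"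
  and ORep_form: "V \<in> ORep n \<alpha> \<Longrightarrow> V n \<in> carrier_mat (\<alpha> n) (\<alpha> n)"
  and ORep_skew: "V \<in> ORep n \<alpha> \<Longrightarrow> transpose_mat (V n) = - V n"
  and ORep_outside: "V \<in> ORep n \<alpha> \<Longrightarrow> i \<notin> {1..n} \<Longrightarrow> V i = 0\<^sub>m 0 0"
  by (auto simp: ORep_def)

lemma ORep_eqI:
  assumes V: "V \<in> ORep n \<alpha>" and W: "W \<in> ORep n \<alpha>"
    and arrow: "\<And>i. 1 \<le> i \<Longrightarrow> i < n \<Longrightarrow> V i = W i" and form: "V n = W n"
  shows "V = W"
proof
  fix i
  consider "1 \<le> i" "i < n" | "i = n" | "i \<notin> {1..n}" by fastforce
  then show "V i = W i"
    by cases (use arrow form ORep_outside[OF V, of i] ORep_outside[OF W, of i] in auto)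
qed

lemma act_arrow: "1 \<le> i \<Longrightarrow> i < n \<Longrightarrow> act n g V i = g (Suc i) * V i * mat_inv (g i)"
  and act_form: "act n g V n = transpose_mat (mat_inv (g n)) * V n * mat_inv (g n)"
  and act_outside: "i \<notin> {1..n} \<Longrightarrow> act n g V i = V i"
  using n_pos by (auto simp: act_def)

lemma act_ORep:
  assumes g: "g \<in> GL" and V: "V \<in> ORep n \<alpha>"
  shows "act n g V \<in> ORep n \<alpha>"
proof (rule ORep_I)
  show "act n g V i \<in> carrier_mat (\<alpha> (Suc i)) (\<alpha> i)" if "1 \<le> i" "i < n" for i
    using that ORep_arrow[OF V that] GL_D(1)[OF g, of "Suc i"] GL_inv_carrier[OF g, of i]
    by (simp add: act_arrow)
  note inv = GL_inv_carrier[OF g n_pos le_refl]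
  show "act n g V n \<in> carrier_mat (\<alpha> n) (\<alpha> n)"
    using ORep_form[OF V] inv by (simp add: act_form)
  show "transpose_mat (act n g V n) = - act n g V n"
    unfolding act_form by (rule skew_mat_congruence[OF ORep_form[OF V] ORep_skew[OF V] inv])
  show "act n g V i = 0\<^sub>m 0 0" if "i \<notin> {1..n}" for i
    using ORep_outside[OF V that] by (simp add: act_outside[OF that])
qed

lemma act_arrow_eqI:
  fixes g V :: "nat \<Rightarrow> 'a::field mat"
  assumes g: "g \<in> GL" and i: "1 \<le> i" "i < n" and W: "W \<in> carrier_mat (\<alpha> (Suc i)) (\<alpha> i)"
    and intertwine: "g (Suc i) * V i = W * g i"
  shows "act n g V i = W"
proof -
  note gi = GL_D[OF g i(1) less_imp_le[OF i(2)]]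
  have "act n g V i = W * (g i * mat_inv (g i))"
    unfolding act_arrow[OF i] intertwine
    using W gi(1) mat_inv_carrier[OF gi] by (intro mult_mat_assoc) auto
  then show ?thesis using W by (simp add: mat_inv_right[OF gi])
qed

lemma act_form_eqI:
  fixes g V :: "nat \<Rightarrow> 'a::field mat"
  assumes g: "g \<in> GL" and W: "W \<in> carrier_mat (\<alpha> n) (\<alpha> n)"
    and congruent: "V n = transpose_mat (g n) * W * g n"
  shows "act n g V n = W"
proof -
  note gn = GL_D[OF g n_pos le_refl]
  note inv = mat_inv_carrier[OF gn]
  have "act n g V n
      = transpose_mat (mat_inv (g n)) * (transpose_mat (g n) * (W * (g n * mat_inv (g n))))"
    unfolding act_form congruent using W gn(1) inv by (simp add: mult_mat_assoc)
  also have "\<dots> = W"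
    using W transpose_mat_inv_mult_cancel(2)[OF gn] by (simp add: mat_inv_right[OF gn])
  finally show ?thesis .
qed

lemma GL_mult:
  assumes "g \<in> GL" "h \<in> GL"
  shows "(\<lambda>i. g i * h i) \<in> GL"
proof (rule GL_I)
  fix i assume "1 \<le> i" "i \<le> n"
  note gi = GL_D[OF assms(1) this] and hi = GL_D[OF assms(2) this]
  show "g i * h i \<in> carrier_mat (\<alpha> i) (\<alpha> i)" "det (g i * h i) \<noteq> 0"
    using gi hi by (simp_all add: det_mult[OF gi(1) hi(1)])
qed

lemma GL_inverse:
  assumes "g \<in> GL"
  shows "(\<lambda>i. mat_inv (g i)) \<in> GL"
proof (rule GL_I)
  fix i assume "1 \<le> i" "i \<le> n"
  note gi = GL_D[OF assms this]
  show "mat_inv (g i) \<in> carrier_mat (\<alpha> i) (\<alpha> i)" "det (mat_inv (g i)) \<noteq> 0"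
    using gi(2) by (simp_all add: mat_inv_carrier[OF gi] det_mat_inv[OF gi])
qed

lemma act_act:
  fixes g h V :: "nat \<Rightarrow> 'a::field mat"
  assumes g: "g \<in> GL" and h: "h \<in> GL" and V: "V \<in> ORep n \<alpha>"
  shows "act n g (act n h V) = act n (\<lambda>i. g i * h i) V"
proof (rule ORep_eqI[OF act_ORep[OF g act_ORep[OF h V]] act_ORep[OF GL_mult[OF g h] V]])
  fix i assume i: "1 \<le> i" "i < n"
  then have "1 \<le> i" "i \<le> n" "1 \<le> Suc i" "Suc i \<le> n" by auto
  note gi = GL_D[OF g this(1,2)] and hi = GL_D[OF h this(1,2)]
    and gS = GL_D[OF g this(3,4)] and hS = GL_D[OF h this(3,4)]
  show "act n g (act n h V) i = act n (\<lambda>i. g i * h i) V i"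
    using gS(1) hS(1) ORep_arrow[OF V i] mat_inv_carrier[OF gi] mat_inv_carrier[OF hi]
    by (simp add: act_arrow[OF i] mat_inv_mult[OF gi hi] mult_mat_assoc)
next
  note gn = GL_D[OF g n_pos le_refl] and hn = GL_D[OF h n_pos le_refl]
  show "act n g (act n h V) n = act n (\<lambda>i. g i * h i) V n"
    using ORep_form[OF V] mat_inv_carrier[OF gn] mat_inv_carrier[OF hn]
    by (simp add: act_form mat_inv_mult[OF gn hn] transpose_mult_mat mult_mat_assoc)
qed

lemma act_cong: "(\<And>i. 1 \<le> i \<Longrightarrow> i \<le> n \<Longrightarrow> g i = h i) \<Longrightarrow> act n g V = act n h V"
  using n_pos by (auto simp: act_def)

lemma act_one:
  assumes "V \<in> ORep n \<alpha>"
  shows "act n (\<lambda>i. 1\<^sub>m (\<alpha> i)) V = V"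
proof -
  have one: "(\<lambda>i. 1\<^sub>m (\<alpha> i)) \<in> GL" by (intro GL_I) auto
  show ?thesis
  proof (rule ORep_eqI[OF act_ORep[OF one assms] assms])
    show "act n (\<lambda>i. 1\<^sub>m (\<alpha> i)) V i = V i" if "1 \<le> i" "i < n" for i
      using ORep_arrow[OF assms that] by (intro act_arrow_eqI[OF one that]) auto
    show "act n (\<lambda>i. 1\<^sub>m (\<alpha> i)) V n = V n"
      using ORep_form[OF assms] by (intro act_form_eqI[OF one]) auto
  qed
qed

lemma act_factor:
  fixes g h V :: "nat \<Rightarrow> 'a::field mat"
  assumes g: "g \<in> GL" and h: "h \<in> GL" and V: "V \<in> ORep n \<alpha>"
  obtains k where "k \<in> GL" "act n g V = act n k (act n h V)"
    "\<And>i. 1 \<le> i \<Longrightarrow> i \<le> n \<Longrightarrow> det (k i) = det (g i) / det (h i)"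
proof
  define k where "k i = g i * mat_inv (h i)" for i
  show k: "k \<in> GL"
    unfolding k_def by (rule GL_mult[OF g GL_inverse[OF h]])
  show "det (k i) = det (g i) / det (h i)" if "1 \<le> i" "i \<le> n" for i
    using GL_D[OF g that] GL_D[OF h that] mat_inv_carrier[OF GL_D[OF h that]]
    by (simp add: k_def det_mult det_mat_inv divide_inverse)
  have "k i * h i = g i" if "1 \<le> i" "i \<le> n" for i
  proof -
    note hi = GL_D[OF h that] and gi = GL_D[OF g that]
    have "k i * h i = g i * (mat_inv (h i) * h i)"
      unfolding k_def using gi(1) hi(1) mat_inv_carrier[OF hi] by (intro mult_mat_assoc) auto
    then show ?thesis using gi(1) by (simp add: mat_inv_left[OF hi])
  qed
  then have "act n (\<lambda>i. k i * h i) V = act n g V" by (intro act_cong)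
  then show "act n g V = act n k (act n h V)" using act_act[OF k h V] by simp
qed

lemma OSI_iff:
  "F \<in> OSI n \<alpha> \<longleftrightarrow> F \<in> agreeing_on (ORep n \<alpha>) (poly_fun n \<alpha>)
    \<and> (\<forall>g\<in>SOgrp n \<alpha>. \<forall>V\<in>ORep n \<alpha>. F (act n g V) = F V)"
  by (simp add: OSI_def agreeing_on_def)

lemma OSI_polynomial:
  assumes "F \<in> OSI n \<alpha>"
  obtains p where "p \<in> poly_fun n \<alpha>" "\<And>V. V \<in> ORep n \<alpha> \<Longrightarrow> F V = p V"
  using assms unfolding OSI_def by blast

lemma OSI_invariant:
  "F \<in> OSI n \<alpha> \<Longrightarrow> g \<in> SOgrp n \<alpha> \<Longrightarrow> V \<in> ORep n \<alpha> \<Longrightarrow> F (act n g V) = F V"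
  by (simp add: OSI_iff)

interpretation reps: function_algebra "ORep n \<alpha>"
  "agreeing_on (ORep n \<alpha>) (poly_fun n \<alpha>) :: ((nat \<Rightarrow> 'a::field_char_0 mat) \<Rightarrow> 'a) set"
  by (rule function_algebra_poly_fun)

lemma function_algebra_OSI:
  "function_algebra (ORep n \<alpha>) (OSI n \<alpha> :: ((nat \<Rightarrow> 'a::field_char_0 mat) \<Rightarrow> 'a) set)"
proof
  fix f h :: "(nat \<Rightarrow> 'a mat) \<Rightarrow> 'a"
  assume f: "f \<in> OSI n \<alpha>" and eq: "\<And>V. V \<in> ORep n \<alpha> \<Longrightarrow> f V = h V"
  have "h (act n g V) = h V" if "g \<in> SOgrp n \<alpha>" "V \<in> ORep n \<alpha>" for g V
    using OSI_invariant[OF f that] eq act_ORep[OF SOgrp_D(1)] that by metis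
  then show "h \<in> OSI n \<alpha>" using f reps.cong[OF _ eq] by (auto simp: OSI_iff)
qed (auto simp: OSI_iff intro: reps.const reps.add reps.mult)

section \<open>The generators are invariant\<close>

lemma mprod_carrier:
  assumes "V \<in> ORep n \<alpha>" "1 \<le> j" "j + k < n"
  shows "mprod V j k \<in> carrier_mat (\<alpha> (Suc (j + k))) (\<alpha> j)"
  using ORep_arrow[OF assms(1), of j] ORep_arrow[OF assms(1), of "j + k"] assms(2,3)
  by (intro carrier_matI) auto

lemma mprod_act:
  fixes g V :: "nat \<Rightarrow> 'a::field mat"
  assumes g: "g \<in> GL" and V: "V \<in> ORep n \<alpha>" and "1 \<le> j" "j + k < n"
  shows "mprod (act n g V) j k = g (Suc (j + k)) * mprod V j k * mat_inv (g j)"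
  using assms(3,4)
proof (induction k)
  case 0
  then show ?case by (simp add: act_arrow)
next
  case (Suc k)
  define l where "l = j + Suc k"
  have l: "1 \<le> l" "l < n" using Suc.prems by (auto simp: l_def)
  note gl = GL_D[OF g l(1) less_imp_le[OF l(2)]]
  have M: "mprod V j k \<in> carrier_mat (\<alpha> l) (\<alpha> j)"
    using mprod_carrier[OF V, of j k] Suc.prems by (simp add: l_def)
  note carriers = M gl(1) mat_inv_carrier[OF gl] ORep_arrow[OF V l]
    GL_D(1)[OF g, of "Suc l"] GL_inv_carrier[OF g, of j]
  have "mprod (act n g V) j (Suc k) = act n g V l * mprod (act n g V) j k" by (simp add: l_def)
  also have "\<dots> = (g (Suc l) * V l * mat_inv (g l)) * (g l * mprod V j k * mat_inv (g j))"
    unfolding act_arrow[OF l] using Suc by (simp add: l_def)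
  also have "\<dots> = g (Suc l) * (V l * (mat_inv (g l) * (g l * (mprod V j k * mat_inv (g j)))))"
    using Suc.prems l carriers by (simp add: mult_mat_assoc del: dim_mprod)
  also have "\<dots> = g (Suc l) * (V l * (mprod V j k * mat_inv (g j)))"
    using M mat_inv_mult_cancel[OF gl] by (simp del: dim_mprod)
  also have "\<dots> = g (Suc l) * (V l * mprod V j k) * mat_inv (g j)"
    using Suc.prems l carriers by (simp add: mult_mat_assoc del: dim_mprod)
  finally show ?case by (simp add: l_def)
qed

lemma mprod_Vfull: "j + k \<le> n \<Longrightarrow> mprod (Vfull n V) j k = mprod V j k"
  by (intro mprod_cong) (auto simp: Vfull_def)

text \<open>The composite \<open>V\<^sub>i \<rightarrow> V\<^sub>i\<^sup>*\<close> of all arrows between \<open>i\<close> and its mirror image.\<close>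

definition dual_composite :: "(nat \<Rightarrow> 'a::field mat) \<Rightarrow> nat \<Rightarrow> 'a mat" where
  "dual_composite V i = mprod (Vfull n V) i (2 * n - 2 * i)"

lemma dual_composite_n [simp]: "dual_composite V n = V n"
  by (simp add: dual_composite_def Vfull_def)

lemma Vfull_composable:
  assumes V: "V \<in> ORep n \<alpha>" and "1 \<le> i" "Suc i < 2 * n"
  shows "dim_col (Vfull n V (Suc i)) = dim_row (Vfull n V i)"
proof -
  consider "Suc i < n" | "Suc i = n" | "i = n" | "n < i" by linarith
  then show ?thesis
  proof cases
    case 1
    then show ?thesis
      using assms(2) ORep_arrow[OF V, of i] ORep_arrow[OF V, of "Suc i"] by (auto simp: Vfull_def)
  next
    case 2
    then show ?thesis
      using assms(2) ORep_arrow[OF V, of i] ORep_form[OF V] by (auto simp: Vfull_def)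
  next
    case 3
    define j where "j = 2 * n - Suc n"
    have "1 \<le> j" "j < n" "Suc j = n" using 3 assms(3) by (auto simp: j_def)
    then show ?thesis
      using 3 ORep_arrow[OF V, of j] ORep_form[OF V] by (auto simp: Vfull_def j_def)
  next
    case 4
    define j where "j = 2 * n - Suc i"
    have "1 \<le> j" "Suc j < n" "2 * n - i = Suc j" using 4 assms(3) by (auto simp: j_def)
    then show ?thesis
      using 4 ORep_arrow[OF V, of j] ORep_arrow[OF V, of "Suc j"] by (auto simp: Vfull_def j_def)
  qed
qed

lemma dual_composite_Suc:
  assumes V: "V \<in> ORep n \<alpha>" and i: "1 \<le> i" "i < n"
  shows "dual_composite V i = - (transpose_mat (V i) * dual_composite V (Suc i) * V i)"
proof -
  define k where "k = 2 * n - 2 * Suc i"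
  define W where "W = Vfull n V"
  have k: "2 * n - 2 * i = Suc (Suc k)" "i + Suc (Suc k) = 2 * n - i" "Suc i + k < 2 * n - i"
    "n < 2 * n - i" "2 * n - (2 * n - i) = i"
    using i by (auto simp: k_def)
  note composable = Vfull_composable[OF V, folded W_def]
  have "dual_composite V i = W (2 * n - i) * mprod W i (Suc k)"
    unfolding dual_composite_def W_def[symmetric] k(1) mprod.simps(2)[of W i "Suc k"] k(2) ..
  also have "mprod W i (Suc k) = mprod W (Suc i) k * W i"
    using i k by (intro mprod_Suc_left composable) auto
  also have "W (2 * n - i) * (mprod W (Suc i) k * W i) = W (2 * n - i) * mprod W (Suc i) k * W i"
  proof (rule mult_mat_assoc[symmetric])
    show "dim_col (W (2 * n - i)) = dim_row (mprod W (Suc i) k)"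
      using composable[of "Suc i + k"] i k(2,3) by simp
    show "dim_col (mprod W (Suc i) k) = dim_row (W i)"
      using composable[of i] i k(3) by simp
  qed
  also have "W (2 * n - i) = - transpose_mat (V i)" unfolding W_def Vfull_def using k by simp
  also have "mprod W (Suc i) k = dual_composite V (Suc i)"
    unfolding dual_composite_def W_def k_def ..
  also have "W i = V i" unfolding W_def Vfull_def using i by simp
  finally have eq: "dual_composite V i = - transpose_mat (V i) * dual_composite V (Suc i) * V i" .
  have "dim_row (dual_composite V (Suc i)) = dim_row (V i)"
    "dim_col (dual_composite V (Suc i)) = dim_row (V i)"
    using composable[of "Suc i + k"] composable[of i] i k
    unfolding dual_composite_def W_def[symmetric] k_def[symmetric]
    by (simp_all add: W_def Vfull_def)
  then show ?thesis unfolding eq by simp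
qed

lemma dual_composite_carrier:
  assumes V: "V \<in> ORep n \<alpha>" and i: "1 \<le> i" "i \<le> n"
  shows "dual_composite V i \<in> carrier_mat (\<alpha> i) (\<alpha> i)"
  using i(2,1)
proof (induction rule: inc_induct)
  case base
  then show ?case using ORep_form[OF V] by simp
next
  case (step i)
  then show ?case using ORep_arrow[OF V, of i] by (simp add: dual_composite_Suc[OF V])
qed

lemma dual_composite_act:
  fixes g V :: "nat \<Rightarrow> 'a::field mat"
  assumes g: "g \<in> GL" and V: "V \<in> ORep n \<alpha>" and i: "1 \<le> i" "i \<le> n"
  shows "dual_composite (act n g V) i
    = transpose_mat (mat_inv (g i)) * dual_composite V i * mat_inv (g i)"
  using i(2,1)
proof (induction rule: inc_induct)
  case base
  then show ?case by (simp add: act_form)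
next
  case (step i)
  then have i: "1 \<le> i" "i < n" and Suc: "1 \<le> Suc i" "Suc i \<le> n" by auto
  define h where "h = mat_inv (g i)"
  define S where "S = dual_composite V (Suc i)"
  note gS = GL_D[OF g Suc]
  have carriers: "g (Suc i) \<in> carrier_mat (\<alpha> (Suc i)) (\<alpha> (Suc i))" "h \<in> carrier_mat (\<alpha> i) (\<alpha> i)"
      "mat_inv (g (Suc i)) \<in> carrier_mat (\<alpha> (Suc i)) (\<alpha> (Suc i))"
      "V i \<in> carrier_mat (\<alpha> (Suc i)) (\<alpha> i)" "S \<in> carrier_mat (\<alpha> (Suc i)) (\<alpha> (Suc i))"
    using gS(1) mat_inv_carrier[OF gS] GL_inv_carrier[OF g, of i] i ORep_arrow[OF V i]
      dual_composite_carrier[OF V Suc] by (auto simp: h_def S_def)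
  have "dual_composite (act n g V) i = - (transpose_mat (act n g V i) *
      (transpose_mat (mat_inv (g (Suc i))) * S * mat_inv (g (Suc i))) * act n g V i)"
    using step i by (simp add: dual_composite_Suc[OF act_ORep[OF g V] i] S_def)
  also have "\<dots> = - (transpose_mat h * (transpose_mat (V i) * (S * (V i * h))))"
    unfolding act_arrow[OF i] h_def[symmetric] using carriers
    by (simp add: transpose_mult_mat mult_mat_assoc mat_inv_mult_cancel[OF gS]
        transpose_mat_inv_mult_cancel[OF gS])
  also have "\<dots> = transpose_mat h * dual_composite V i * h"
    unfolding dual_composite_Suc[OF V i] S_def[symmetric] using carriers
    by (simp add: mult_mat_assoc)
  finally show ?case by (simp add: h_def)
qed

lemma arrow_Mat: "1 \<le> i \<Longrightarrow> i < n \<Longrightarrow> (\<lambda>V. V i) \<in> reps.Mat (\<alpha> (Suc i)) (\<alpha> i)"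
  and form_Mat: "(\<lambda>V. V n) \<in> reps.Mat (\<alpha> n) (\<alpha> n)"
  by (auto intro!: reps.Mat_I intro: ORep_arrow ORep_form agreeing_onI[OF poly_fun.coord1]
      agreeing_onI[OF poly_fun.coord2])

lemma mprod_Mat:
  assumes "1 \<le> j" "j + k < n"
  shows "(\<lambda>V. mprod V j k) \<in> reps.Mat (\<alpha> (Suc (j + k))) (\<alpha> j)"
  using assms
proof (induction k)
  case (Suc k)
  then show ?case
    using reps.Mat_mult[OF arrow_Mat[of "j + Suc k"], of "\<lambda>V. mprod V j k" "\<alpha> j"] by simp
qed (simp add: arrow_Mat)

lemma dual_composite_Mat:
  assumes "1 \<le> i" "i \<le> n"
  shows "(\<lambda>V :: nat \<Rightarrow> 'a::field_char_0 mat. dual_composite V i) \<in> reps.Mat (\<alpha> i) (\<alpha> i)"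
  using assms(2,1)
proof (induction rule: inc_induct)
  case base
  show ?case by (simp add: form_Mat)
next
  case (step i)
  then have i: "1 \<le> i" "i < n" by auto
  note A = arrow_Mat[OF i]
  have S: "(\<lambda>V :: nat \<Rightarrow> 'a mat. dual_composite V (Suc i)) \<in> reps.Mat (\<alpha> (Suc i)) (\<alpha> (Suc i))"
    using step.IH by simp
  have "(\<lambda>V :: nat \<Rightarrow> 'a mat. - (transpose_mat (V i) * dual_composite V (Suc i) * V i))
      \<in> reps.Mat (\<alpha> i) (\<alpha> i)"
    by (rule reps.Mat_uminus[OF reps.Mat_mult[OF reps.Mat_mult[OF reps.Mat_transpose[OF A] S] A]])
  then show ?case by (rule reps.Mat_cong) (simp add: dual_composite_Suc[OF _ i])
qed

lemma det_path_in_OSI: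
  assumes "1 \<le> j" "j + k < n" "\<alpha> j = \<alpha> (Suc (j + k))"
  shows "(\<lambda>V :: nat \<Rightarrow> 'a::field_char_0 mat. det (mprod V j k)) \<in> OSI n \<alpha>"
  unfolding OSI_iff
proof (intro conjI ballI)
  show "(\<lambda>V :: nat \<Rightarrow> 'a mat. det (mprod V j k)) \<in> agreeing_on (ORep n \<alpha>) (poly_fun n \<alpha>)"
    using mprod_Mat[OF assms(1,2)] assms(3) by (intro reps.det[of _ "\<alpha> j"]) simp
  fix g V :: "nat \<Rightarrow> 'a mat" assume g: "g \<in> SOgrp n \<alpha>" and V: "V \<in> ORep n \<alpha>"
  have ends: "1 \<le> j" "j \<le> n" "1 \<le> Suc (j + k)" "Suc (j + k) \<le> n" using assms(1,2) by auto
  note source = GL_D[OF SOgrp_D(1)[OF g] ends(1,2)] and target = GL_D[OF SOgrp_D(1)[OF g] ends(3,4)]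
  show "det (mprod (act n g V) j k) = det (mprod V j k)"
    using source target(1) mat_inv_carrier[OF source] mprod_carrier[OF V assms(1,2)] assms(3)
    by (simp add: mprod_act[OF SOgrp_D(1)[OF g] V assms(1,2)] det_mult[of _ "\<alpha> j"]
        det_mat_inv[OF source] SOgrp_D(2)[OF g ends(1,2)] SOgrp_D(2)[OF g ends(3,4)] del: dim_mprod)
qed

lemma pf_dual_composite_in_OSI:
  assumes i: "1 \<le> i" "i \<le> n" and "even (\<alpha> i)"
  shows "(\<lambda>V :: nat \<Rightarrow> 'a::field_char_0 mat. pf (dual_composite V i)) \<in> OSI n \<alpha>"
  unfolding OSI_iff
proof (intro conjI ballI)
  obtain m where m: "\<alpha> i = 2 * m" using assms(3) by (elim evenE)
  show "(\<lambda>V :: nat \<Rightarrow> 'a mat. pf (dual_composite V i)) \<in> agreeing_on (ORep n \<alpha>) (poly_fun n \<alpha>)"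
    using dual_composite_Mat[OF i] by (intro reps.pf[of _ m]) (simp add: m)
  fix g V :: "nat \<Rightarrow> 'a mat" assume g: "g \<in> SOgrp n \<alpha>" and V: "V \<in> ORep n \<alpha>"
  note gi = GL_D[OF SOgrp_D(1)[OF g] i]
  have "pf (dual_composite (act n g V) i) = det (mat_inv (g i)) * pf (dual_composite V i)"
    unfolding dual_composite_act[OF SOgrp_D(1)[OF g] V i]
    by (rule pf_congruence[OF dual_composite_carrier[OF V i, unfolded m]
          mat_inv_carrier[OF gi, unfolded m]])
  then show "pf (dual_composite (act n g V) i) = pf (dual_composite V i)"
    by (simp add: det_mat_inv[OF gi] SOgrp_D(2)[OF g i])
qed

lemma generators_eq:
  "generators n \<alpha> =
     {\<lambda>V. det (mprod V j k) |j k.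
        1 \<le> j \<and> j + k < n \<and> \<alpha> j = \<alpha> (Suc (j + k)) \<and> (\<forall>l\<in>{j+1..j+k}. \<alpha> j < \<alpha> l)}
   \<union> {\<lambda>V. pf (dual_composite V i) |i.
        1 \<le> i \<and> i \<le> n \<and> (\<forall>l\<in>{i+1..n}. \<alpha> i < \<alpha> l) \<and> even (\<alpha> i)}"
    (is "_ = ?det \<union> _")
proof -
  have "{f. \<exists>i j. 1 \<le> j \<and> j \<le> i \<and> i \<le> n - 1 \<and> \<alpha> j = \<alpha> (Suc i) \<and> (\<forall>k\<in>{j+1..i}. \<alpha> j < \<alpha> k)
      \<and> f = (\<lambda>V. det (mprod (Vfull n V) j (i - j)))} = ?det" (is "?lhs = _")
  proof (intro equalityI subsetI)
    fix f assume "f \<in> ?lhs"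
    then obtain i j where ij: "1 \<le> j" "j \<le> i" "i \<le> n - 1" "\<alpha> j = \<alpha> (Suc i)"
        "\<forall>k\<in>{j+1..i}. \<alpha> j < \<alpha> k"
      and "f = (\<lambda>V. det (mprod (Vfull n V) j (i - j)))" by blast
    then have "f = (\<lambda>V. det (mprod V j (i - j)))" by (simp add: mprod_Vfull)
    then show "f \<in> ?det" using ij by (intro CollectI exI[of _ j] exI[of _ "i - j"]) auto
  next
    fix f assume "f \<in> ?det"
    then obtain j k where "1 \<le> j" "j + k < n" "\<alpha> j = \<alpha> (Suc (j + k))"
        "\<forall>l\<in>{j+1..j+k}. \<alpha> j < \<alpha> l"
      and "f = (\<lambda>V. det (mprod V j k))" by blast
    then show "f \<in> ?lhs"
      by (intro CollectI exI[of _ "j + k"] exI[of _ j]) (auto simp: mprod_Vfull)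
  qed
  then show ?thesis unfolding generators_def dual_composite_def by auto
qed

lemma generators_subset_OSI:
  "(generators n \<alpha> :: ((nat \<Rightarrow> 'a::field_char_0 mat) \<Rightarrow> 'a) set) \<subseteq> OSI n \<alpha>"
  unfolding generators_eq by (auto intro: det_path_in_OSI pf_dual_composite_in_OSI)

section \<open>Monomial representations\<close>

definition monomial_rep :: "(nat \<Rightarrow> nat \<Rightarrow> 'a::field) \<Rightarrow> nat \<Rightarrow> 'a mat" where
  "monomial_rep x i =
    (if 1 \<le> i \<and> i < n then rect_diag (\<alpha> (Suc i)) (\<alpha> i) (x i)
     else if i = n then hyperbolic_mat (\<alpha> n) (x n) else 0\<^sub>m 0 0)"

lemma monomial_rep_arrow:
    "1 \<le> i \<Longrightarrow> i < n \<Longrightarrow> monomial_rep x i = rect_diag (\<alpha> (Suc i)) (\<alpha> i) (x i)"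
  and monomial_rep_form [simp]: "monomial_rep x n = hyperbolic_mat (\<alpha> n) (x n)"
  by (auto simp: monomial_rep_def)

lemma monomial_rep_ORep: "monomial_rep x \<in> ORep n \<alpha>"
  using n_pos by (intro ORep_I) (auto simp: monomial_rep_def)

lemma monomial_rep_cong:
  assumes "\<And>i r. 1 \<le> i \<Longrightarrow> i \<le> n \<Longrightarrow> r < \<alpha> i \<Longrightarrow> x i r = y i r"
  shows "monomial_rep x = monomial_rep y"
  using assms n_pos
  by (intro ORep_eqI monomial_rep_ORep)
    (auto simp: monomial_rep_arrow intro!: rect_diag_cong hyperbolic_mat_cong)

definition path_weight :: "(nat \<Rightarrow> nat \<Rightarrow> 'a::field) \<Rightarrow> nat \<Rightarrow> nat \<Rightarrow> nat \<Rightarrow> 'a" where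
  "path_weight x j k r = (\<Prod>l\<in>{j..k}. if r < \<alpha> l then x l r else 0)"

lemma mprod_monomial_rep:
  assumes "1 \<le> j" "j + k < n"
  shows "mprod (monomial_rep x) j k = rect_diag (\<alpha> (Suc (j + k))) (\<alpha> j) (path_weight x j (j + k))"
  using assms
proof (induction k)
  case 0
  then show ?case by (auto simp: monomial_rep_arrow path_weight_def intro!: rect_diag_cong)
next
  case (Suc k)
  then have "mprod (monomial_rep x) j (Suc k)
      = rect_diag (\<alpha> (Suc (j + Suc k))) (\<alpha> (j + Suc k)) (x (j + Suc k))
        * rect_diag (\<alpha> (j + Suc k)) (\<alpha> j) (path_weight x j (j + k))"
    by (simp add: monomial_rep_arrow)
  also have "\<dots> = rect_diag (\<alpha> (Suc (j + Suc k))) (\<alpha> j) (path_weight x j (j + Suc k))"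
    unfolding rect_diag_mult by (intro rect_diag_cong) (auto simp: path_weight_def)
  finally show ?case .
qed

lemma dual_composite_monomial_rep:
  fixes x :: "nat \<Rightarrow> nat \<Rightarrow> 'a::field"
  assumes "1 \<le> i" "i \<le> n"
  shows "dual_composite (monomial_rep x) i
    = (-1) ^ (n - i) \<cdot>\<^sub>m hyperbolic_mat (\<alpha> i) (path_weight x i n)"
  using assms(2,1)
proof (induction rule: inc_induct)
  case base
  show ?case by (intro eq_matI) (auto simp: path_weight_def)
next
  case (step i)
  then have i: "1 \<le> i" "i < n" by auto
  define c :: 'a where "c = (-1) ^ (n - Suc i)"
  have sign: "- c = (-1) ^ (n - i)" using i by (simp add: c_def flip: Suc_diff_Suc)
  have "{i..n} = insert i {Suc i..n}" using i by auto
  then have weight: "path_weight x i n r = x i r * path_weight x (Suc i) n r" if "r < \<alpha> i" for r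
    using that by (simp add: path_weight_def)
  have short: "path_weight x (Suc i) n r = 0" if "\<not> r < \<alpha> (Suc i)" for r
    unfolding path_weight_def using that i by (intro prod_zero) auto
  have "dual_composite (monomial_rep x) (Suc i)
      = c \<cdot>\<^sub>m hyperbolic_mat (\<alpha> (Suc i)) (path_weight x (Suc i) n)"
    using step.IH i by (simp add: c_def)
  then have "dual_composite (monomial_rep x) i = - (c \<cdot>\<^sub>m hyperbolic_mat (\<alpha> i)
      (\<lambda>r. if r < \<alpha> (Suc i) then path_weight x (Suc i) n r * x i r else 0))"
    by (simp only: dual_composite_Suc[OF monomial_rep_ORep i] monomial_rep_arrow[OF i]
        rect_diag_congruence_smult_hyperbolic_mat)
  also have "\<dots> = (- c) \<cdot>\<^sub>m hyperbolic_mat (\<alpha> i) (path_weight x i n)"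
    by (intro eq_matI) (auto simp: weight short)
  finally show ?case by (simp only: sign)
qed

definition last_weight :: "(nat \<Rightarrow> 'a::one) \<Rightarrow> nat \<Rightarrow> nat \<Rightarrow> 'a" where
  "last_weight t i r = (if Suc r = \<alpha> i then t i else 1)"

definition section_rep :: "(nat \<Rightarrow> 'a::field) \<Rightarrow> nat \<Rightarrow> 'a mat" where
  "section_rep t = monomial_rep (last_weight t)"

lemma path_weight_last_weight:
  assumes "j \<le> k" "\<forall>l\<in>{j+1..k}. \<alpha> j < \<alpha> l" "r < \<alpha> j"
  shows "path_weight (last_weight t) j k r = last_weight t j r"
proof -
  have "{j..k} = insert j {j+1..k}" using assms(1) by auto
  then have "path_weight (last_weight t) j k r
      = last_weight t j r * (\<Prod>l\<in>{j+1..k}. if r < \<alpha> l then last_weight t l r else 0)"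
    using assms(3) by (simp add: path_weight_def)
  also have "(\<Prod>l\<in>{j+1..k}. if r < \<alpha> l then last_weight t l r else 0) = 1"
  proof (intro prod.neutral ballI)
    fix l assume "l \<in> {j+1..k}"
    then have "Suc r < \<alpha> l" using assms(2,3) by fastforce
    then show "(if r < \<alpha> l then last_weight t l r else 0) = 1" by (simp add: last_weight_def)
  qed
  finally show ?thesis by simp
qed

lemma prod_last_weight:
  fixes t :: "nat \<Rightarrow> 'a::comm_monoid_mult"
  assumes "\<alpha> j > 0"
  shows "(\<Prod>r<\<alpha> j. last_weight t j r) = t j"
  using assms by (cases "\<alpha> j") (auto simp: last_weight_def)

lemma det_path_section_rep:
  assumes "1 \<le> j" "j + k < n" "\<alpha> j = \<alpha> (Suc (j + k))" "\<forall>l\<in>{j+1..j+k}. \<alpha> j < \<alpha> l" "\<alpha> j > 0"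
  shows "det (mprod (section_rep t) j k) = t j"
proof -
  have "mprod (section_rep t) j k = rect_diag (\<alpha> j) (\<alpha> j) (last_weight t j)"
    unfolding section_rep_def mprod_monomial_rep[OF assms(1,2)] assms(3)[symmetric]
    using assms(4) by (intro rect_diag_cong path_weight_last_weight) auto
  then show ?thesis by (simp add: det_rect_diag prod_last_weight[OF assms(5)])
qed

lemma pf_dual_composite_section_rep:
  assumes i: "1 \<le> i" "i \<le> n" and "\<forall>l\<in>{i+1..n}. \<alpha> i < \<alpha> l" "even (\<alpha> i)" "\<alpha> i > 0"
  obtains c :: "'a::field_char_0" where "c \<noteq> 0"
    "\<And>t. pf (dual_composite (section_rep t) i) = c * t i"
proof -
  obtain m where m: "\<alpha> i = 2 * m" using assms(4) by (elim evenE)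
  define c :: 'a where "c = ((-1) ^ (n - i)) ^ m * pf (hyperbolic_mat (2 * m) (\<lambda>_. 1))"
  show thesis
  proof (rule that)
    show "c \<noteq> 0" using pf_hyperbolic_mat_nonzero[of m, where ?'a = 'a] by (simp add: c_def)
    fix t :: "nat \<Rightarrow> 'a"
    have "dual_composite (section_rep t) i
        = (-1) ^ (n - i) \<cdot>\<^sub>m hyperbolic_mat (2 * m) (last_weight t i)"
      unfolding section_rep_def dual_composite_monomial_rep[OF i] m[symmetric]
      using i(2) assms(3)
      by (intro arg_cong[of _ _ "\<lambda>A. _ \<cdot>\<^sub>m A"] hyperbolic_mat_cong path_weight_last_weight)
    moreover have "(\<Prod>r<2 * m. last_weight t i r) = t i"
      unfolding m[symmetric] by (rule prod_last_weight[OF assms(5)])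
    ultimately show "pf (dual_composite (section_rep t) i) = c * t i"
      by (simp add: pf_smult[of _ m] pf_hyperbolic_mat[of m "last_weight t i"] c_def)
  qed
qed

section \<open>The slice\<close>

definition generator_vertex :: "nat \<Rightarrow> bool" where
  "generator_vertex j \<longleftrightarrow>
     (\<exists>k. j + k < n \<and> \<alpha> j = \<alpha> (Suc (j + k)) \<and> (\<forall>l\<in>{j+1..j+k}. \<alpha> j < \<alpha> l))
     \<or> (\<forall>l\<in>{j+1..n}. \<alpha> j < \<alpha> l) \<and> even (\<alpha> j)"

definition slice :: "(nat \<Rightarrow> 'a::field mat) set" where
  "slice = {section_rep t |t. \<forall>j. \<not> generator_vertex j \<longrightarrow> t j = 1}"

lemma section_rep_slice: "(\<And>j. \<not> generator_vertex j \<Longrightarrow> t j = 1) \<Longrightarrow> section_rep t \<in> slice"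
  by (auto simp: slice_def)

lemma slice_subset_ORep: "slice \<subseteq> ORep n \<alpha>"
  by (auto simp: slice_def section_rep_def monomial_rep_ORep)

lemma generator_vertex_parameter:
  assumes j: "1 \<le> j" "j \<le> n" and "generator_vertex j" and pos: "\<alpha> j > 0"
  obtains f where "f \<in> alg_gen (generators n \<alpha>)"
    "\<And>t :: nat \<Rightarrow> 'a::field_char_0. f (section_rep t) = t j"
  using assms(3) unfolding generator_vertex_def
proof (elim disjE exE conjE)
  fix k assume k: "j + k < n" "\<alpha> j = \<alpha> (Suc (j + k))" "\<forall>l\<in>{j+1..j+k}. \<alpha> j < \<alpha> l"
  have "(\<lambda>V :: nat \<Rightarrow> 'a mat. det (mprod V j k)) \<in> alg_gen (generators n \<alpha>)"
    using j k unfolding generators_eq by (intro alg_gen.gen UnI1) blast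
  then show thesis by (rule that) (rule det_path_section_rep[OF j(1) k pos])
next
  assume min: "\<forall>l\<in>{j+1..n}. \<alpha> j < \<alpha> l" "even (\<alpha> j)"
  obtain c :: 'a where c: "c \<noteq> 0" "\<And>t. pf (dual_composite (section_rep t) j) = c * t j"
    using pf_dual_composite_section_rep[OF j min pos] by blast
  have "(\<lambda>V :: nat \<Rightarrow> 'a mat. inverse c * pf (dual_composite V j)) \<in> alg_gen (generators n \<alpha>)"
    using j min unfolding generators_eq by (intro alg_gen.mult alg_gen.const alg_gen.gen UnI2) blast
  then show thesis by (rule that) (simp add: c)
qed

lemma alg_gen_last_weight:
  assumes "1 \<le> j" "j \<le> n" "r < \<alpha> j"
  obtains f where "f \<in> alg_gen (generators n \<alpha>)"
    "\<And>t :: nat \<Rightarrow> 'a::field_char_0. (\<And>j. \<not> generator_vertex j \<Longrightarrow> t j = 1) \<Longrightarrow>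
      f (section_rep t) = last_weight t j r"
proof (cases "Suc r = \<alpha> j \<and> generator_vertex j")
  case True
  with assms obtain f where "f \<in> alg_gen (generators n \<alpha>)"
    "\<And>t :: nat \<Rightarrow> 'a. f (section_rep t) = t j"
    using generator_vertex_parameter[of j] by auto
  then show thesis using True by (intro that[of f]) (auto simp: last_weight_def)
next
  case False
  then show thesis by (intro that[of "\<lambda>V. 1"] alg_gen.const) (auto simp: last_weight_def)
qed

lemma poly_fun_on_slice:
  "(poly_fun n \<alpha> :: ((nat \<Rightarrow> 'a::field_char_0 mat) \<Rightarrow> 'a) set)
    \<subseteq> agreeing_on slice (alg_gen (generators n \<alpha>))"
proof
  let ?S = "agreeing_on slice (alg_gen (generators n \<alpha>)) :: ((nat \<Rightarrow> 'a mat) \<Rightarrow> 'a) set"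
  interpret function_algebra slice ?S by (rule function_algebra_alg_gen)
  have weight: "\<exists>f\<in>?S. \<forall>t. (\<forall>j. \<not> generator_vertex j \<longrightarrow> t j = 1) \<longrightarrow>
      f (section_rep t) = last_weight t j r"
    if "1 \<le> j" "j \<le> n" "r < \<alpha> j" for j r
    using alg_gen_last_weight[OF that, where ?'a = 'a] agreeing_onI[where ?D = slice] by metis
  have carrier: "V \<in> ORep n \<alpha>" if "V \<in> slice" for V :: "nat \<Rightarrow> 'a mat"
    using that slice_subset_ORep by blast
  fix p :: "(nat \<Rightarrow> 'a mat) \<Rightarrow> 'a" assume "p \<in> poly_fun n \<alpha>"
  then show "p \<in> ?S"
  proof (rule poly_fun_comp)
    fix i assume i: "1 \<le> i" "i < n"
    show "(\<lambda>V. V i) \<in> Mat (\<alpha> (Suc i)) (\<alpha> i)"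
    proof (rule Mat_I[OF ORep_arrow[OF carrier i]])
      fix r s assume rs: "r < \<alpha> (Suc i)" "s < \<alpha> i"
      obtain f where f: "f \<in> ?S"
        "\<And>t. (\<forall>j. \<not> generator_vertex j \<longrightarrow> t j = 1) \<Longrightarrow> f (section_rep t) = last_weight t i s"
        using weight[of i s] i rs by auto
      show "(\<lambda>V. V i $$ (r, s)) \<in> ?S"
        by (rule cong[OF mult[OF const[of "if r = s then 1 else 0"] f(1)]])
          (use i rs f(2) in \<open>auto simp: slice_def section_rep_def monomial_rep_arrow\<close>)
    qed
  next
    show "(\<lambda>V. V n) \<in> Mat (\<alpha> n) (\<alpha> n)"
    proof (rule Mat_I[OF ORep_form[OF carrier]])
      fix r s assume rs: "r < \<alpha> n" "s < \<alpha> n"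
      obtain f h where f: "f \<in> ?S"
          "\<And>t. (\<forall>j. \<not> generator_vertex j \<longrightarrow> t j = 1) \<Longrightarrow> f (section_rep t) = last_weight t n r"
        and h: "h \<in> ?S"
          "\<And>t. (\<forall>j. \<not> generator_vertex j \<longrightarrow> t j = 1) \<Longrightarrow> h (section_rep t) = last_weight t n s"
        using weight[of n r] weight[of n s] n_pos rs by auto
      show "(\<lambda>V. V n $$ (r, s)) \<in> ?S"
        by (rule cong[OF mult[OF mult[OF const[of "hyperbolic r s"] f(1)] h(1)]])
          (use rs f(2) h(2) in \<open>auto simp: slice_def section_rep_def\<close>)
    qed
  qed
qed

section \<open>Reduction by the torus\<close>

definition diagonal :: "(nat \<Rightarrow> nat \<Rightarrow> 'a::zero) \<Rightarrow> nat \<Rightarrow> 'a mat" where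
  "diagonal \<delta> i = rect_diag (\<alpha> i) (\<alpha> i) (\<delta> i)"

lemma diagonal_GL:
  "(\<And>i r. 1 \<le> i \<Longrightarrow> i \<le> n \<Longrightarrow> r < \<alpha> i \<Longrightarrow> \<delta> i r \<noteq> 0) \<Longrightarrow> diagonal \<delta> \<in> GL"
  by (intro GL_I) (auto simp: diagonal_def det_rect_diag)

lemma diagonal_SOgrp:
  "(\<And>i. 1 \<le> i \<Longrightarrow> i \<le> n \<Longrightarrow> (\<Prod>r<\<alpha> i. \<delta> i r) = 1) \<Longrightarrow> diagonal \<delta> \<in> SOgrp n \<alpha>"
  by (auto simp: SOgrp_def diagonal_def det_rect_diag)

lemma act_diagonal_monomial_rep:
  fixes x y \<delta> :: "nat \<Rightarrow> nat \<Rightarrow> 'a::field"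
  assumes GL: "diagonal \<delta> \<in> GL"
    and arrow: "\<And>i r. 1 \<le> i \<Longrightarrow> i < n \<Longrightarrow> r < \<alpha> i \<Longrightarrow> r < \<alpha> (Suc i) \<Longrightarrow>
      \<delta> (Suc i) r * x i r = y i r * \<delta> i r"
    and form: "\<And>r s. r < \<alpha> n \<Longrightarrow> s < \<alpha> n \<Longrightarrow> hyperbolic r s \<noteq> (0::'a) \<Longrightarrow>
      x n r * x n s = (y n r * \<delta> n r) * (y n s * \<delta> n s)"
  shows "act n (diagonal \<delta>) (monomial_rep x) = monomial_rep y"
proof (rule ORep_eqI[OF act_ORep[OF GL monomial_rep_ORep] monomial_rep_ORep])
  fix i assume i: "1 \<le> i" "i < n"
  show "act n (diagonal \<delta>) (monomial_rep x) i = monomial_rep y i"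
    unfolding monomial_rep_arrow[OF i]
  proof (rule act_arrow_eqI[OF GL i rect_diag_carrier])
    show "diagonal \<delta> (Suc i) * monomial_rep x i = rect_diag (\<alpha> (Suc i)) (\<alpha> i) (y i) * diagonal \<delta> i"
      unfolding diagonal_def monomial_rep_arrow[OF i] rect_diag_mult
      by (rule rect_diag_cong) (simp add: arrow[OF i])
  qed
next
  show "act n (diagonal \<delta>) (monomial_rep x) n = monomial_rep y n"
    unfolding monomial_rep_form
  proof (rule act_form_eqI[OF GL hyperbolic_mat_carrier])
    have "hyperbolic r s * x n r * x n s = hyperbolic r s * (y n r * \<delta> n r) * (y n s * \<delta> n s)"
      if "r < \<alpha> n" "s < \<alpha> n" for r s
      using form[OF that] by (cases "hyperbolic r s = (0::'a)") (simp_all add: mult.assoc)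
    then show "monomial_rep x n
        = transpose_mat (diagonal \<delta> n) * hyperbolic_mat (\<alpha> n) (y n) * diagonal \<delta> n"
      unfolding monomial_rep_form diagonal_def rect_diag_congruence_hyperbolic_mat
      by (intro eq_matI) auto
  qed
qed

lemma OSI_torus_invariant:
  fixes x y \<delta> :: "nat \<Rightarrow> nat \<Rightarrow> 'a::field"
  assumes F: "F \<in> OSI n \<alpha>" and det: "\<And>i. 1 \<le> i \<Longrightarrow> i \<le> n \<Longrightarrow> (\<Prod>r<\<alpha> i. \<delta> i r) = 1"
    and arrow: "\<And>i r. 1 \<le> i \<Longrightarrow> i < n \<Longrightarrow> r < \<alpha> i \<Longrightarrow> r < \<alpha> (Suc i) \<Longrightarrow>
      \<delta> (Suc i) r * x i r = y i r * \<delta> i r"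
    and form: "\<And>r s. r < \<alpha> n \<Longrightarrow> s < \<alpha> n \<Longrightarrow> hyperbolic r s \<noteq> (0::'a) \<Longrightarrow>
      x n r * x n s = (y n r * \<delta> n r) * (y n s * \<delta> n s)"
  shows "F (monomial_rep x) = F (monomial_rep y)"
proof -
  have SO: "diagonal \<delta> \<in> SOgrp n \<alpha>" by (rule diagonal_SOgrp[OF det])
  have "act n (diagonal \<delta>) (monomial_rep x) = monomial_rep y"
    by (rule act_diagonal_monomial_rep[OF SOgrp_D(1)[OF SO] arrow form])
  then show ?thesis using OSI_invariant[OF F SO monomial_rep_ORep, of x] by simp
qed

lemma not_generator_vertexE:
  assumes "\<not> generator_vertex j" "j \<le> n"
  obtains k where "j \<le> k" "k \<le> n" "\<forall>l\<in>{j+1..k}. \<alpha> j < \<alpha> l"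
    "k = n \<Longrightarrow> odd (\<alpha> j)" "k < n \<Longrightarrow> \<alpha> (Suc k) < \<alpha> j"
proof -
  define K where "K = {k. j \<le> k \<and> k \<le> n \<and> (\<forall>l\<in>{j+1..k}. \<alpha> j < \<alpha> l)}"
  have fin: "finite K" by (rule finite_subset[of _ "{..n}"]) (auto simp: K_def)
  have "j \<in> K" using assms(2) by (simp add: K_def)
  define k where "k = Max K"
  have "k \<in> K" unfolding k_def using fin \<open>j \<in> K\<close> by (intro Max_in) auto
  then have k: "j \<le> k" "k \<le> n" "\<forall>l\<in>{j+1..k}. \<alpha> j < \<alpha> l" by (auto simp: K_def)
  show thesis
  proof (rule that[OF k])
    show "odd (\<alpha> j)" if "k = n" using that k assms(1) by (auto simp: generator_vertex_def)
    assume "k < n"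
    have "Suc k \<notin> K" using Max_ge[OF fin, of "Suc k"] by (auto simp: k_def)
    then have "\<not> \<alpha> j < \<alpha> (Suc k)" using k \<open>k < n\<close> by (auto simp: K_def le_Suc_eq)
    moreover have "\<alpha> j \<noteq> \<alpha> (Suc k)"
    proof
      assume "\<alpha> j = \<alpha> (Suc k)"
      then have "generator_vertex j"
        unfolding generator_vertex_def using k \<open>k < n\<close>
        by (intro disjI1 exI[of _ "k - j"]) auto
      then show False using assms(1) by simp
    qed
    ultimately show "\<alpha> (Suc k) < \<alpha> j" by linarith
  qed
qed

text \<open>A parameter at a vertex where no generator starts sits on a chain of basis vectors which, just
  above it, is accompanied by a chain of exactly the same length without its initial vertex. Scaling
  the two by inverse factors has determinant one and absorbs the parameter.\<close>

definition chain_scaling :: "nat \<Rightarrow> nat \<Rightarrow> 'a::field \<Rightarrow> nat \<Rightarrow> nat \<Rightarrow> 'a" where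
  "chain_scaling j k c i r = (if j < i \<and> i \<le> k
     then (if Suc r = \<alpha> j then c else 1) * (if r = \<alpha> j then inverse c else 1) else 1)"

lemma prod_chain_scaling:
  assumes "c \<noteq> 0" "\<alpha> j > 0" "\<forall>l\<in>{j+1..k}. \<alpha> j < \<alpha> l"
  shows "(\<Prod>r<\<alpha> i. chain_scaling j k c i r) = 1"
proof (cases "j < i \<and> i \<le> k")
  case True
  then have "\<alpha> j < \<alpha> i" using assms(3) by auto
  moreover have "(\<Prod>r<\<alpha> i. if Suc r = \<alpha> j then c else 1)
      = (\<Prod>r<\<alpha> i. if r = \<alpha> j - 1 then c else 1)"
    using assms(2) by (intro prod.cong) auto
  ultimately show ?thesis
    using True assms(1,2) by (simp add: chain_scaling_def prod.distrib prod.delta)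
qed (auto simp: chain_scaling_def intro!: prod.neutral)

lemma chain_scaling_arrow:
  assumes "j \<le> k" "i = k \<Longrightarrow> \<alpha> (Suc i) < \<alpha> j" "c * t j = 1" "r < \<alpha> i" "r < \<alpha> (Suc i)"
  shows "chain_scaling j k c (Suc i) r * last_weight t i r
    = last_weight (t(j := 1)) i r * chain_scaling j k c i r"
proof -
  consider "i < j" | "i = j" "j < k" | "i = k" | "j < i" "i < k" | "k < i"
    using assms(1) by linarith
  then show ?thesis
    by cases (use assms in \<open>auto simp: chain_scaling_def last_weight_def\<close>)
qed

lemma chain_scaling_form:
  assumes "odd (\<alpha> j)" and "c \<noteq> 0" and nz: "hyperbolic r s \<noteq> (0::'a::field)"
  shows "chain_scaling j k c i r * chain_scaling j k c i s = (1::'a)"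
proof -
  obtain e where "\<alpha> j = 2 * e + 1" using assms(1) by (elim oddE)
  moreover have "hyperbolic s r \<noteq> (0::'a)" using nz by (simp add: hyperbolic_skew[of s r])
  ultimately show ?thesis
    using hyperbolic_partner[OF nz, of e] hyperbolic_partner[of s r e, where ?'a = 'a] assms(2)
    by (auto simp: chain_scaling_def)
qed

lemma last_weight_form_reset:
  fixes t :: "nat \<Rightarrow> 'a::field"
  assumes "j = n \<Longrightarrow> odd (\<alpha> n)" "hyperbolic r s \<noteq> (0::'a)" "r < \<alpha> n" "s < \<alpha> n"
  shows "last_weight t n r = last_weight (t(j := 1)) n r"
proof (cases "j = n \<and> Suc r = \<alpha> n")
  case True
  then obtain e where "\<alpha> n = 2 * e + 1" using assms(1) by (blast elim: oddE)
  then show ?thesis using True hyperbolic_partner[OF assms(2), of e] assms(4) by simp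
qed (auto simp: last_weight_def)

lemma OSI_section_rep_reset:
  fixes t :: "nat \<Rightarrow> 'a::field"
  assumes F: "F \<in> OSI n \<alpha>" and j: "j \<le> n" "\<not> generator_vertex j" and tj: "t j \<noteq> 0"
  shows "F (section_rep t) = F (section_rep (t(j := 1)))"
proof -
  obtain k where k: "j \<le> k" "k \<le> n" "\<forall>l\<in>{j+1..k}. \<alpha> j < \<alpha> l"
    and end_form: "k = n \<Longrightarrow> odd (\<alpha> j)" and end_arrow: "k < n \<Longrightarrow> \<alpha> (Suc k) < \<alpha> j"
    using not_generator_vertexE[OF j(2,1)] by metis
  have pos: "\<alpha> j > 0" using k(2) end_form end_arrow by (cases "k = n") (auto simp: odd_pos)
  define c where "c = inverse (t j)"
  have c: "c \<noteq> 0" "c * t j = 1" using tj by (auto simp: c_def)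
  show ?thesis
    unfolding section_rep_def
  proof (rule OSI_torus_invariant[OF F])
    show "(\<Prod>r<\<alpha> i. chain_scaling j k c i r) = 1" for i
      by (rule prod_chain_scaling[OF c(1) pos k(3)])
    show "chain_scaling j k c (Suc i) r * last_weight t i r
        = last_weight (t(j := 1)) i r * chain_scaling j k c i r"
      if "i < n" "r < \<alpha> i" "r < \<alpha> (Suc i)" for i r
      by (rule chain_scaling_arrow) (use that k(1) end_arrow c(2) in auto)
    fix r s assume rs: "r < \<alpha> n" "s < \<alpha> n" "hyperbolic r s \<noteq> (0::'a)"
    then have sr: "hyperbolic s r \<noteq> (0::'a)" by (simp add: hyperbolic_skew[of s r])
    have odd: "odd (\<alpha> n)" if "j = n" using that end_form k(1,2) by auto
    have "chain_scaling j k c n r * chain_scaling j k c n s = 1"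
    proof (cases "k = n")
      case True
      then show ?thesis by (intro chain_scaling_form[OF end_form c(1) rs(3)])
    qed (use k(2) in \<open>simp add: chain_scaling_def\<close>)
    moreover note last_weight_form_reset[where t = t, OF odd rs(3,1,2)]
      last_weight_form_reset[where t = t, OF odd sr rs(2,1)]
    ultimately show "last_weight t n r * last_weight t n s
        = (last_weight (t(j := 1)) n r * chain_scaling j k c n r)
        * (last_weight (t(j := 1)) n s * chain_scaling j k c n s)"
      by (simp add: mult_ac)
  qed
qed

lemma OSI_section_rep_eq_0:
  fixes t :: "nat \<Rightarrow> 'a::field"
  assumes F: "F \<in> OSI n \<alpha>" and slice: "\<And>V. V \<in> slice \<Longrightarrow> F V = 0"
    and "\<And>i. 1 \<le> i \<Longrightarrow> i \<le> n \<Longrightarrow> t i \<noteq> 0"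
  shows "F (section_rep t) = 0"
proof -
  have "F (section_rep t) = 0"
    if "j \<le> n" "\<And>i. 1 \<le> i \<Longrightarrow> i \<le> n \<Longrightarrow> t i \<noteq> 0"
      "\<And>i. j < i \<Longrightarrow> i \<le> n \<Longrightarrow> \<not> generator_vertex i \<Longrightarrow> t i = 1" for j t
    using that
  proof (induction j arbitrary: t)
    case 0
    have "section_rep t = section_rep (\<lambda>j. if generator_vertex j then t j else 1)"
      unfolding section_rep_def using 0(3) by (intro monomial_rep_cong) (auto simp: last_weight_def)
    then show ?case using slice[OF section_rep_slice] by simp
  next
    case (Suc j)
    show ?case
    proof (cases "generator_vertex (Suc j)")
      case True
      then have "t i = 1" if "j < i" "i \<le> n" "\<not> generator_vertex i" for i
        using Suc.prems(3)[of i] that by (cases "i = Suc j") auto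
      then show ?thesis using Suc.prems(1,2) by (intro Suc.IH) auto
    next
      case False
      have "F (section_rep (t(Suc j := 1))) = 0"
      proof (rule Suc.IH)
        show "(t(Suc j := 1)) i = 1" if "j < i" "i \<le> n" "\<not> generator_vertex i" for i
          using Suc.prems(3)[of i] that by (cases "i = Suc j") auto
      qed (use Suc.prems(1,2) in auto)
      then show ?thesis
        using OSI_section_rep_reset[OF F Suc.prems(1) False, of t] Suc.prems(1,2) by simp
    qed
  qed
  from this[of n] assms(3) show ?thesis by simp
qed

lemma OSI_normalise_vertex:
  fixes x :: "nat \<Rightarrow> nat \<Rightarrow> 'a::field"
  assumes F: "F \<in> OSI n \<alpha>" and nz: "\<And>i r. x i r \<noteq> 0" and j: "1 \<le> j" "j \<le> n"
  obtains y where "\<And>i r. y i r \<noteq> 0" "F (monomial_rep x) = F (monomial_rep y)"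
    "\<And>r. Suc r \<noteq> \<alpha> j \<Longrightarrow> y j r = 1" "\<And>i r. j < i \<Longrightarrow> y i r = x i r"
proof
  define \<delta> where "\<delta> i r =
    (if i = j then if Suc r = \<alpha> j then inverse (\<Prod>q<r. x j q) else x j r else 1)" for i r
  define y where "y i r = \<delta> (Suc i) r * x i r / \<delta> i r" for i r
  have \<delta>_nz: "\<delta> i r \<noteq> 0" for i r using nz by (simp add: \<delta>_def)
  then show "y i r \<noteq> 0" for i r using nz by (simp add: y_def)
  show "y j r = 1" if "Suc r \<noteq> \<alpha> j" for r using that nz by (simp add: y_def \<delta>_def)
  show "y i r = x i r" if "j < i" for i r using that by (simp add: y_def \<delta>_def)
  have y_\<delta>: "y i r * \<delta> i r = \<delta> (Suc i) r * x i r" for i r using \<delta>_nz by (simp add: y_def)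
  show "F (monomial_rep x) = F (monomial_rep y)"
  proof (rule OSI_torus_invariant[OF F])
    show "(\<Prod>r<\<alpha> i. \<delta> i r) = 1" for i
    proof (cases "i = j \<and> \<alpha> j > 0")
      case True
      then obtain d where "\<alpha> j = Suc d" by (auto simp: gr0_conv_Suc)
      moreover have "(\<Prod>q<d. x j q) \<noteq> 0" using nz by simp
      ultimately show ?thesis using True by (simp add: \<delta>_def)
    qed (auto simp: \<delta>_def intro!: prod.neutral)
    show "\<delta> (Suc i) r * x i r = y i r * \<delta> i r" for i r by (simp add: y_\<delta>)
    show "x n r * x n s = (y n r * \<delta> n r) * (y n s * \<delta> n s)" for r s
      using j(2) unfolding y_\<delta> by (simp add: \<delta>_def)
  qed
qed

lemma OSI_monomial_rep_eq_0:
  fixes x :: "nat \<Rightarrow> nat \<Rightarrow> 'a::field"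
  assumes F: "F \<in> OSI n \<alpha>" and slice: "\<And>V. V \<in> slice \<Longrightarrow> F V = 0" and nz: "\<And>i r. x i r \<noteq> 0"
  shows "F (monomial_rep x) = 0"
proof -
  have "F (monomial_rep x) = 0"
    if "j \<le> n" "\<And>i r. x i r \<noteq> 0" "\<And>i r. j < i \<Longrightarrow> i \<le> n \<Longrightarrow> Suc r \<noteq> \<alpha> i \<Longrightarrow> x i r = 1" for j x
    using that
  proof (induction j arbitrary: x)
    case 0
    define t where "t i = x i (\<alpha> i - 1)" for i
    have "monomial_rep x = section_rep t"
      unfolding section_rep_def
    proof (rule monomial_rep_cong)
      fix i r assume "1 \<le> i" "i \<le> n" "r < \<alpha> i"
      moreover have "x i r = t i" if "Suc r = \<alpha> i" using that by (simp add: t_def flip: that)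
      ultimately show "x i r = last_weight t i r"
        using 0(3)[of i r] by (auto simp: last_weight_def)
    qed
    moreover have "F (section_rep t) = 0"
      using 0(2) by (intro OSI_section_rep_eq_0[OF F slice]) (simp_all add: t_def)
    ultimately show ?case by simp
  next
    case (Suc j)
    obtain y where y: "\<And>i r. y i r \<noteq> 0" "F (monomial_rep x) = F (monomial_rep y)"
      "\<And>r. Suc r \<noteq> \<alpha> (Suc j) \<Longrightarrow> y (Suc j) r = 1" "\<And>i r. Suc j < i \<Longrightarrow> y i r = x i r"
      by (rule OSI_normalise_vertex[where x = x and j = "Suc j", OF F Suc.prems(2)])
        (use Suc.prems(1) in auto)
    have "F (monomial_rep y) = 0"
    proof (rule Suc.IH[OF _ y(1)])
      show "y i r = 1" if "j < i" "i \<le> n" "Suc r \<noteq> \<alpha> i" for i r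
        using that y(3)[of r] y(4)[of i r] Suc.prems(3)[of i r] by (cases "i = Suc j") auto
    qed (use Suc.prems(1) in simp)
    then show ?case by (simp add: y(2))
  qed
  from this[of n] nz show ?thesis by simp
qed

abbreviation standard_rep :: "nat \<Rightarrow> 'a::field mat" where
  "standard_rep \<equiv> monomial_rep (\<lambda>_ _. 1)"

lemma OSI_open_orbit_eq_0:
  fixes g :: "nat \<Rightarrow> 'a::field mat"
  assumes F: "F \<in> OSI n \<alpha>" and slice: "\<And>V. V \<in> slice \<Longrightarrow> F V = 0" and g: "g \<in> GL"
  shows "F (act n g standard_rep) = 0"
proof -
  define \<delta> where "\<delta> i r = (if 1 \<le> i \<and> i \<le> n \<and> Suc r = \<alpha> i then det (g i) else 1)" for i r
  define y where "y i r = \<delta> (if i = n then 0 else Suc i) r / \<delta> i r" for i r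
  have \<delta>_nz: "\<delta> i r \<noteq> 0" for i r using GL_D[OF g] by (simp add: \<delta>_def)
  then have GL: "diagonal \<delta> \<in> GL" by (intro diagonal_GL)
  have det: "det (diagonal \<delta> i) = det (g i)" if i: "1 \<le> i" "i \<le> n" for i
  proof (cases "\<alpha> i")
    case 0
    then show ?thesis using GL_D(1)[OF g i] by (simp add: diagonal_def)
  next
    case (Suc d)
    then show ?thesis using i by (simp add: diagonal_def det_rect_diag \<delta>_def)
  qed
  have act: "act n (diagonal \<delta>) standard_rep = monomial_rep y"
  proof (rule act_diagonal_monomial_rep[OF GL])
    have "y n r * \<delta> n r = 1" for r using \<delta>_nz[of n r] by (simp add: y_def) (simp add: \<delta>_def)
    then show "1 * 1 = (y n r * \<delta> n r) * (y n s * \<delta> n s)" for r s by simp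
    show "\<delta> (Suc i) r * 1 = y i r * \<delta> i r" if "i < n" for i r
      using that \<delta>_nz[of i r] by (simp add: y_def)
  qed
  obtain k where k: "k \<in> GL" "act n g standard_rep = act n k (act n (diagonal \<delta>) standard_rep)"
    "\<And>i. 1 \<le> i \<Longrightarrow> i \<le> n \<Longrightarrow> det (k i) = det (g i) / det (diagonal \<delta> i)"
    using act_factor[OF g GL monomial_rep_ORep] by metis
  have "k \<in> SOgrp n \<alpha>"
    using k(1,3) GL_D[OF g] by (auto simp: SOgrp_def GL_def det)
  then have "F (act n g standard_rep) = F (monomial_rep y)"
    unfolding k(2) act by (rule OSI_invariant[OF F _ monomial_rep_ORep])
  also have "\<dots> = 0"
    using \<delta>_nz by (intro OSI_monomial_rep_eq_0[OF F slice]) (simp_all add: y_def)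
  finally show ?thesis .
qed

section \<open>Lines of representations\<close>

definition line :: "(nat \<Rightarrow> 'a::field mat) \<Rightarrow> (nat \<Rightarrow> 'a mat) \<Rightarrow> 'a \<Rightarrow> nat \<Rightarrow> 'a mat" where
  "line V W x i = mat_line (V i) (W i) x"

lemma line_ORep:
  assumes V: "V \<in> ORep n \<alpha>" and W: "W \<in> ORep n \<alpha>"
  shows "line V W x \<in> ORep n \<alpha>"
proof (rule ORep_I)
  note forms = ORep_form[OF V] ORep_form[OF W]
  show "line V W x i \<in> carrier_mat (\<alpha> (Suc i)) (\<alpha> i)" if "1 \<le> i" "i < n" for i
    unfolding line_def by (rule mat_line_carrier[OF ORep_arrow[OF V that] ORep_arrow[OF W that]])
  show form: "line V W x n \<in> carrier_mat (\<alpha> n) (\<alpha> n)"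
    unfolding line_def by (rule mat_line_carrier[OF forms])
  show "transpose_mat (line V W x n) = - line V W x n"
  proof (rule skew_matI[OF form])
    fix r s assume rs: "r < \<alpha> n" "s < \<alpha> n"
    show "line V W x n $$ (r, s) = - line V W x n $$ (s, r)"
      unfolding line_def index_mat_line[OF forms rs] index_mat_line[OF forms rs(2,1)]
      using index_skew_mat[OF forms(1) ORep_skew[OF V] rs]
        index_skew_mat[OF forms(2) ORep_skew[OF W] rs]
      by (simp add: algebra_simps)
  qed
  show "line V W x i = 0\<^sub>m 0 0" if "i \<notin> {1..n}" for i
    using ORep_outside[OF V that] ORep_outside[OF W that] by (simp add: line_def)
qed

lemma line_0:
  assumes V: "V \<in> ORep n \<alpha>" and W: "W \<in> ORep n \<alpha>"
  shows "line V W 0 = V"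
proof (rule ORep_eqI[OF line_ORep[OF V W] V])
  show "line V W 0 i = V i" if "1 \<le> i" "i < n" for i
    unfolding line_def by (rule mat_line_0[OF ORep_arrow[OF V that] ORep_arrow[OF W that]])
  show "line V W 0 n = V n"
    unfolding line_def by (rule mat_line_0[OF ORep_form[OF V] ORep_form[OF W]])
qed

lemma OSI_act_line_poly:
  fixes F :: "(nat \<Rightarrow> 'a::field_char_0 mat) \<Rightarrow> 'a"
  assumes F: "F \<in> OSI n \<alpha>" and V: "V \<in> ORep n \<alpha>" and W: "W \<in> ORep n \<alpha>" and g: "g \<in> GL"
  shows "(\<lambda>x. F (act n g (line V W x))) \<in> range poly"
proof -
  obtain p where p: "p \<in> poly_fun n \<alpha>" and Fp: "\<And>V. V \<in> ORep n \<alpha> \<Longrightarrow> F V = p V"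
    by (rule OSI_polynomial[OF F]) blast
  note inv = GL_inv_carrier[OF g]
  have "(\<lambda>x. p (act n g (line V W x))) \<in> range poly"
  proof (rule line.poly_fun_comp[OF p])
    fix i assume i: "1 \<le> i" "i < n"
    have "(\<lambda>x. g (Suc i) * mat_line (V i) (W i) x * mat_inv (g i)) \<in> line.Mat (\<alpha> (Suc i)) (\<alpha> i)"
      by (rule line.Mat_mult[OF line.Mat_mult[OF line.Mat_const mat_line_Mat] line.Mat_const])
        (use i GL_D(1)[OF g] inv ORep_arrow[OF V i] ORep_arrow[OF W i] in auto)
    then show "(\<lambda>x. act n g (line V W x) i) \<in> line.Mat (\<alpha> (Suc i)) (\<alpha> i)"
      by (simp only: act_arrow[OF i] line_def)
  next
    have "(\<lambda>x. transpose_mat (mat_inv (g n)) * mat_line (V n) (W n) x * mat_inv (g n))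
        \<in> line.Mat (\<alpha> n) (\<alpha> n)"
      by (rule line.Mat_mult[OF line.Mat_mult[OF line.Mat_const mat_line_Mat] line.Mat_const])
        (use n_pos inv ORep_form[OF V] ORep_form[OF W] in auto)
    then show "(\<lambda>x. act n g (line V W x) n) \<in> line.Mat (\<alpha> n) (\<alpha> n)"
      by (simp only: act_form line_def)
  qed
  then show ?thesis by (simp add: Fp act_ORep[OF g line_ORep[OF V W]])
qed

section \<open>Density of the open orbit\<close>

definition null_orbits :: "((nat \<Rightarrow> 'a::field mat) \<Rightarrow> 'a) \<Rightarrow> (nat \<Rightarrow> 'a mat) set" where
  "null_orbits F = {V \<in> ORep n \<alpha>. \<forall>g\<in>GL. F (act n g V) = 0}"

lemma null_orbits_act:
  assumes V: "V \<in> ORep n \<alpha>" and g: "g \<in> GL" and null: "act n g V \<in> null_orbits F"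
  shows "V \<in> null_orbits F"
proof -
  have "F (act n h V) = 0" if h: "h \<in> GL" for h
    by (rule act_factor[OF h g V]) (use null in \<open>auto simp: null_orbits_def\<close>)
  then show ?thesis using V by (auto simp: null_orbits_def)
qed

lemma null_orbits_line:
  fixes F :: "(nat \<Rightarrow> 'a::field_char_0 mat) \<Rightarrow> 'a"
  assumes F: "F \<in> OSI n \<alpha>" and V: "V \<in> ORep n \<alpha>" and W: "W \<in> ORep n \<alpha>"
    and h: "h \<in> range poly" "h 1 \<noteq> 0"
    and generic: "\<And>x. h x \<noteq> 0 \<Longrightarrow> line V W x \<in> null_orbits F"
  shows "V \<in> null_orbits F"
proof -
  obtain q where q: "h = poly q" using h(1) by auto
  have "F (act n g V) = 0" if g: "g \<in> GL" for g
  proof -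
    obtain p where p: "(\<lambda>x. F (act n g (line V W x))) = poly p"
      using OSI_act_line_poly[OF F V W g] by auto
    have "poly (p * q) x = 0" for x
      using generic[of x] g fun_cong[OF p, of x] by (auto simp: null_orbits_def q)
    then have "p * q = 0" by (simp only: poly_all_0_iff_0[symmetric]) simp
    moreover have "q \<noteq> 0" using h(2) q by auto
    ultimately have "p = 0" by simp
    then show ?thesis using fun_cong[OF p, of 0] line_0[OF V W] by simp
  qed
  then show ?thesis using V by (auto simp: null_orbits_def)
qed

lemma triangular_stabiliser:
  fixes U :: "'a::field mat"
  assumes "1 \<le> j" "U \<in> carrier_mat (\<alpha> j) (\<alpha> j)" "upper_triangular U" "det U \<noteq> 0"
  obtains g where "g \<in> GL" "g j = U"
    "\<And>i. 1 \<le> i \<Longrightarrow> i < j \<Longrightarrow>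
      g (Suc i) * partial_id (\<alpha> (Suc i)) (\<alpha> i) = partial_id (\<alpha> (Suc i)) (\<alpha> i) * g i"
  using assms
proof (induction j arbitrary: U thesis rule: dec_induct)
  case base
  show ?case
    by (rule base(1)[of "\<lambda>i. if i = 1 then U else 1\<^sub>m (\<alpha> i)"]) (use base(2-) in \<open>auto simp: GL_def\<close>)
next
  case (step j)
  obtain U' where U': "U' \<in> carrier_mat (\<alpha> j) (\<alpha> j)" "upper_triangular U'" "det U' \<noteq> 0"
    "U * partial_id (\<alpha> (Suc j)) (\<alpha> j) = partial_id (\<alpha> (Suc j)) (\<alpha> j) * U'"
    by (rule upper_triangular_mult_partial_id[OF step.prems(2-4)])
  obtain g where g: "g \<in> GL" "g j = U'"
    "\<And>i. 1 \<le> i \<Longrightarrow> i < j \<Longrightarrow>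
      g (Suc i) * partial_id (\<alpha> (Suc i)) (\<alpha> i) = partial_id (\<alpha> (Suc i)) (\<alpha> i) * g i"
    using step.IH[OF _ U'(1-3)] by blast
  show ?case
  proof (rule step.prems(1))
    show "g(Suc j := U) \<in> GL" using g(1) step.prems(2,4) by (auto simp: GL_def)
    show "(g(Suc j := U)) (Suc i) * partial_id (\<alpha> (Suc i)) (\<alpha> i)
        = partial_id (\<alpha> (Suc i)) (\<alpha> i) * (g(Suc j := U)) i" if "1 \<le> i" "i < Suc j" for i
      using that g(2,3) U'(4) by (cases "i = j") auto
  qed simp
qed

definition standard_below :: "nat \<Rightarrow> (nat \<Rightarrow> 'a::field mat) \<Rightarrow> bool" where
  "standard_below j V \<longleftrightarrow> (\<forall>i. 1 \<le> i \<and> i < j \<longrightarrow> V i = partial_id (\<alpha> (Suc i)) (\<alpha> i))"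

lemma standard_belowI:
    "(\<And>i. 1 \<le> i \<Longrightarrow> i < j \<Longrightarrow> V i = partial_id (\<alpha> (Suc i)) (\<alpha> i)) \<Longrightarrow> standard_below j V"
  and standard_belowD: "standard_below j V \<Longrightarrow> 1 \<le> i \<Longrightarrow> i < j \<Longrightarrow> V i = partial_id (\<alpha> (Suc i)) (\<alpha> i)"
  by (auto simp: standard_below_def)

lemma standard_below_line:
  assumes V: "standard_below j V" and W: "standard_below j W"
  shows "standard_below j (line V W x)"
proof (rule standard_belowI)
  fix i assume i: "1 \<le> i" "i < j"
  have "V i = W i" using standard_belowD[OF V i] standard_belowD[OF W i] by simp
  then show "line V W x i = partial_id (\<alpha> (Suc i)) (\<alpha> i)"
    using standard_belowD[OF V i] by (simp add: line_def flip: \<open>V i = W i\<close>)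
qed

lemma standardise_arrow:
  assumes j: "1 \<le> j" "j < n" and V: "V \<in> ORep n \<alpha>" and below: "standard_below j V"
    and X: "det (completion (V j)) \<noteq> 0"
  obtains g where "g \<in> GL" "standard_below (Suc j) (act n g V)"
proof -
  define G where "G = mat_inv (completion (V j))"
  note completion = completion_carrier[OF ORep_arrow[OF V j]]
  have G: "G \<in> carrier_mat (\<alpha> (Suc j)) (\<alpha> (Suc j))" "det G \<noteq> 0"
    unfolding G_def using mat_inv_carrier[OF completion X] det_mat_inv[OF completion X] X by auto
  obtain U where U: "U \<in> carrier_mat (\<alpha> j) (\<alpha> j)" "upper_triangular U" "det U \<noteq> 0"
    "G * V j = partial_id (\<alpha> (Suc j)) (\<alpha> j) * U"
    unfolding G_def by (rule completion_normal_form[OF ORep_arrow[OF V j] X])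
  obtain h where h: "h \<in> GL" "h j = U"
    "\<And>i. 1 \<le> i \<Longrightarrow> i < j \<Longrightarrow>
      h (Suc i) * partial_id (\<alpha> (Suc i)) (\<alpha> i) = partial_id (\<alpha> (Suc i)) (\<alpha> i) * h i"
    by (rule triangular_stabiliser[OF j(1) U(1-3)]) blast
  define g where "g = h(Suc j := G)"
  have g: "g \<in> GL" using h(1) G by (auto simp: g_def GL_def)
  have "act n g V i = partial_id (\<alpha> (Suc i)) (\<alpha> i)" if i: "1 \<le> i" "i < Suc j" for i
  proof (rule act_arrow_eqI[OF g i(1) _ rect_diag_carrier])
    show "i < n" using i j by simp
    show "g (Suc i) * V i = partial_id (\<alpha> (Suc i)) (\<alpha> i) * g i"
    proof (cases "i = j")
      case True
      then show ?thesis using h(2) U(4) by (simp add: g_def)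
    next
      case False
      then show ?thesis using i h(3)[of i] standard_belowD[OF below, of i] by (simp add: g_def)
    qed
  qed
  then show thesis using g by (intro that standard_belowI)
qed

lemma null_orbits_arrow:
  fixes F :: "(nat \<Rightarrow> 'a::field_char_0 mat) \<Rightarrow> 'a"
  assumes F: "F \<in> OSI n \<alpha>" and j: "1 \<le> j" "j < n"
    and null: "\<And>V. V \<in> ORep n \<alpha> \<Longrightarrow> standard_below (Suc j) V \<Longrightarrow> V \<in> null_orbits F"
    and V: "V \<in> ORep n \<alpha>" and below: "standard_below j V"
  shows "V \<in> null_orbits F"
proof -
  define W where "W = V(j := partial_id (\<alpha> (Suc j)) (\<alpha> j))"
  have W: "W \<in> ORep n \<alpha>" and W_below: "standard_below j W"
    using V j below by (auto simp: ORep_def W_def standard_below_def)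
  note carriers = ORep_arrow[OF V j] ORep_arrow[OF W j]
  show ?thesis
  proof (rule null_orbits_line[OF F V W])
    show "(\<lambda>x. det (completion (line V W x j))) \<in> range poly"
      unfolding line_def by (rule line.det[OF line.Mat_completion[OF mat_line_Mat[OF carriers]]])
    have "line V W 1 j = partial_id (\<alpha> (Suc j)) (\<alpha> j)"
      using mat_line_1[OF carriers] by (simp add: line_def W_def)
    then show "det (completion (line V W 1 j)) \<noteq> 0" by (simp add: completion_partial_id)
    fix x assume generic: "det (completion (line V W x j)) \<noteq> 0"
    note X = line_ORep[OF V W]
    obtain g where g: "g \<in> GL" "standard_below (Suc j) (act n g (line V W x))"
      by (rule standardise_arrow[OF j X standard_below_line[OF below W_below] generic])
    show "line V W x \<in> null_orbits F"
      by (rule null_orbits_act[OF X g(1) null[OF act_ORep[OF g(1) X] g(2)]])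
  qed
qed

lemma standardise_form_plane:
  fixes V :: "nat \<Rightarrow> 'a::field_char_0 mat"
  assumes V: "V \<in> ORep n \<alpha>" and below: "standard_below n V" and upto: "hyperbolic_upto k (V n)"
    and k: "2 * k + 1 < \<alpha> n" and pivot: "V n $$ (2 * k, 2 * k + 1) \<noteq> 0"
  obtains g where "g \<in> GL" "standard_below n (act n g V)" "hyperbolic_upto (Suc k) (act n g V n)"
proof -
  obtain U B where U: "U \<in> carrier_mat (\<alpha> n) (\<alpha> n)" "upper_triangular U" "det U \<noteq> 0"
    and B: "B \<in> carrier_mat (\<alpha> n) (\<alpha> n)" "hyperbolic_upto (Suc k) B"
    and congruent: "V n = transpose_mat U * B * U"
    by (rule split_hyperbolic_plane[OF ORep_form[OF V] ORep_skew[OF V] k upto pivot])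
  obtain g where g: "g \<in> GL" "g n = U"
    "\<And>i. 1 \<le> i \<Longrightarrow> i < n \<Longrightarrow>
      g (Suc i) * partial_id (\<alpha> (Suc i)) (\<alpha> i) = partial_id (\<alpha> (Suc i)) (\<alpha> i) * g i"
    by (rule triangular_stabiliser[OF n_pos U]) blast
  show thesis
  proof (rule that[OF g(1)])
    show "standard_below n (act n g V)"
    proof (rule standard_belowI)
      fix i assume i: "1 \<le> i" "i < n"
      show "act n g V i = partial_id (\<alpha> (Suc i)) (\<alpha> i)"
        using g(3)[OF i] standard_belowD[OF below i] by (intro act_arrow_eqI[OF g(1) i]) simp_all
    qed
    have "act n g V n = B"
      using congruent g(2) by (intro act_form_eqI[OF g(1) B(1)]) simp
    then show "hyperbolic_upto (Suc k) (act n g V n)" using B(2) by simp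
  qed
qed

lemma standard_below_standard_rep: "j \<le> n \<Longrightarrow> standard_below j standard_rep"
  by (simp add: standard_below_def monomial_rep_arrow)

lemma eq_standard_repI:
  fixes V :: "nat \<Rightarrow> 'a::field_char_0 mat"
  assumes V: "V \<in> ORep n \<alpha>" and below: "standard_below n V"
    and upto: "hyperbolic_upto k (V n)" "\<alpha> n \<le> 2 * k + 1"
  shows "V = standard_rep"
proof (rule ORep_eqI[OF V monomial_rep_ORep])
  show "V i = standard_rep i" if "1 \<le> i" "i < n" for i
    using standard_belowD[OF below that] by (simp add: monomial_rep_arrow[OF that])
  show "V n = standard_rep n"
    using hyperbolic_upto_eq_hyperbolic_mat[OF ORep_form[OF V] ORep_skew[OF V] upto] by simp
qed

lemma null_orbits_form:
  fixes F :: "(nat \<Rightarrow> 'a::field_char_0 mat) \<Rightarrow> 'a"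
  assumes F: "F \<in> OSI n \<alpha>" and null: "standard_rep \<in> null_orbits F"
    and "V \<in> ORep n \<alpha>" "standard_below n V" "hyperbolic_upto k (V n)"
  shows "V \<in> null_orbits F"
  using assms(3-)
proof (induction "\<alpha> n - 2 * k" arbitrary: k V rule: less_induct)
  case less
  note V = less.prems(1) and below = less.prems(2) and upto = less.prems(3)
  note E = monomial_rep_ORep[of "\<lambda>_ _. 1 :: 'a"]
  show ?case
  proof (cases "2 * k + 1 < \<alpha> n")
    case False
    then have "V = standard_rep" by (intro eq_standard_repI[OF V below upto]) simp
    then show ?thesis using null by simp
  next
    case True
    note carriers = ORep_form[OF V] ORep_form[OF E]
    show ?thesis
    proof (rule null_orbits_line[OF F V E])
      show "(\<lambda>x. line V standard_rep x n $$ (2 * k, 2 * k + 1)) \<in> range poly"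
        unfolding line_def using True by (intro line.Mat_entry[OF mat_line_Mat[OF carriers]]) auto
      show "line V standard_rep 1 n $$ (2 * k, 2 * k + 1) \<noteq> 0"
        using True mat_line_1[OF carriers] by (simp add: line_def hyperbolic_def)
      fix x assume generic: "line V standard_rep x n $$ (2 * k, 2 * k + 1) \<noteq> 0"
      let ?X = "line V standard_rep x"
      note X = line_ORep[OF V E]
      have X_below: "standard_below n ?X"
        by (rule standard_below_line[OF below standard_below_standard_rep[OF le_refl]])
      have X_upto: "hyperbolic_upto k (?X n)"
        using hyperbolic_upto_mat_line[OF carriers upto]
        by (simp add: line_def hyperbolic_upto_hyperbolic_mat)
      obtain g where g: "g \<in> GL" "standard_below n (act n g ?X)"
        "hyperbolic_upto (Suc k) (act n g ?X n)"
        by (rule standardise_form_plane[OF X X_below X_upto True generic])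
      have "act n g ?X \<in> null_orbits F"
        using True g(2,3) act_ORep[OF g(1) X] by (intro less.hyps[of "Suc k"]) auto
      then show "?X \<in> null_orbits F" by (rule null_orbits_act[OF X g(1)])
    qed
  qed
qed

lemma OSI_eq_0:
  fixes F :: "(nat \<Rightarrow> 'a::field_char_0 mat) \<Rightarrow> 'a"
  assumes F: "F \<in> OSI n \<alpha>" and slice: "\<And>V. V \<in> slice \<Longrightarrow> F V = 0" and V: "V \<in> ORep n \<alpha>"
  shows "F V = 0"
proof -
  have null: "standard_rep \<in> null_orbits F"
    using OSI_open_orbit_eq_0[OF F slice] by (auto simp: null_orbits_def monomial_rep_ORep)
  have "V \<in> null_orbits F" if "1 \<le> j" "j \<le> n" "V \<in> ORep n \<alpha>" "standard_below j V" for j V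
    using that(2,1,3,4)
  proof (induction arbitrary: V rule: inc_induct)
    case base
    then show ?case by (intro null_orbits_form[OF F null, of _ 0]) (auto simp: hyperbolic_upto_def)
  next
    case (step j)
    show ?case
      by (rule null_orbits_arrow[OF F step.prems(1) step.hyps(2) step.IH step.prems(2,3)]) auto
  qed
  from this[OF le_refl n_pos V] have "V \<in> null_orbits F" by (simp add: standard_below_def)
  moreover have "(\<lambda>i. 1\<^sub>m (\<alpha> i)) \<in> GL" by (auto simp: GL_def)
  ultimately show ?thesis using act_one[OF V] by (force simp: null_orbits_def)
qed

end

theorem theorem2p5:
  fixes n :: nat and \<alpha> :: "nat \<Rightarrow> nat"
  assumes "n \<ge> 1"
  shows "(generators n \<alpha> :: ((nat \<Rightarrow> 'a::{alg_closed_field, field_char_0} mat) \<Rightarrow> 'a) set)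
           \<subseteq> OSI n \<alpha>
    \<and> (\<forall>f \<in> (OSI n \<alpha> :: ((nat \<Rightarrow> 'a mat) \<Rightarrow> 'a) set).
         \<exists>h \<in> alg_gen (generators n \<alpha>). \<forall>V \<in> ORep n \<alpha>. f V = h V)"
proof (intro conjI ballI)
  interpret symmetric_quiver n \<alpha> by unfold_locales (rule assms)
  interpret OSI: function_algebra "ORep n \<alpha>" "OSI n \<alpha> :: ((nat \<Rightarrow> 'a mat) \<Rightarrow> 'a) set"
    by (rule function_algebra_OSI)
  show gens: "(generators n \<alpha> :: ((nat \<Rightarrow> 'a mat) \<Rightarrow> 'a) set) \<subseteq> OSI n \<alpha>"
    by (rule generators_subset_OSI)
  fix f :: "(nat \<Rightarrow> 'a mat) \<Rightarrow> 'a" assume f: "f \<in> OSI n \<alpha>"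
  then obtain p where p: "p \<in> poly_fun n \<alpha>" and fp: "\<And>V. V \<in> ORep n \<alpha> \<Longrightarrow> f V = p V"
    by (rule OSI_polynomial) blast
  obtain h where h: "h \<in> alg_gen (generators n \<alpha>)" and ph: "\<And>V. V \<in> slice \<Longrightarrow> p V = h V"
    by (rule agreeing_onE[OF subsetD[OF poly_fun_on_slice p]]) blast
  have "h \<in> OSI n \<alpha>" using OSI.alg_gen_subset[OF gens] h by blast
  then have "(\<lambda>V. f V - h V) \<in> OSI n \<alpha>" by (rule OSI.diff[OF f])
  moreover have "f V - h V = 0" if "V \<in> slice" for V
    using that slice_subset_ORep by (auto simp: fp ph)
  ultimately have "f V - h V = 0" if "V \<in> ORep n \<alpha>" for V
    using OSI_eq_0 that by blast
  then show "\<exists>h \<in> alg_gen (generators n \<alpha>). \<forall>V \<in> ORep n \<alpha>. f V = h V"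
    using h by auto
qed

end
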